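(* Let $G(\lambda)\in\mathbb F(\lambda)^{p\times m}$ and let $L(\lambda)$ be a strong block minimal bases linearization of $G(\lambda)$ as in the context. (a) If $\varepsilon_1\le\dots\le\varepsilon_l$ are the right minimal indices of $G(\lambda)$, then $\varepsilon_1+\deg N_1(\lambda)\le\dots\le\varepsilon_l+\deg N_1(\lambda)$ are the right minimal indices of $L(\lambda)$. (b) If $\eta_1\le\dots\le\eta_q$ are the left minimal indices of $G(\lambda)$, then $\eta_1+\deg N_2(\lambda)\le\dots\le\eta_q+\deg N_2(\lambda)$ are the left minimal indices of $L(\lambda)$.
   Context: $\mathbb F$ is an arbitrary field. A polynomial matrix $K\in\mathbb F[\lambda]^{a\times b}$, $a<b$, is a minimal basis if its rows form a minimal basis (polynomial basis of least total degree) of the subspace they span; $K\in\mathbb F[\lambda]^{a_1\times b}$, $N\in\mathbb F[\lambda]^{a_2\times b}$ are dual minimal bases if both are minimal bases, $a_1+a_2=b$ and $KN^T=0$. Strong block minimal bases linearization: write $G=D+C(\lambda I_n-A)^{-1}B$ with $D$ the polynomial part, $\deg D>1$, and $C(\lambda I_n-A)^{-1}B$ a minimal order state-space realization of the strictly proper part. Let $K_1\in\mathbb F[\lambda]^{\widehat m\times(m+\widehat m)}$, $K_2\in\mathbb F[\lambda]^{\widehat p\times(p+\widehat p)}$ be minimal bases with all row degrees $1$, $N_1\in\mathbb F[\lambda]^{m\times(m+\widehat m)}$, $N_2\in\mathbb F[\lambda]^{p\times(p+\widehat p)}$ minimal bases dual to $K_1,K_2$, each with all row degrees equal, and $M(\lambda)$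 a $(p+\widehat p)\times(m+\widehat m)$ pencil with $D=N_2MN_1^T$ and $\deg D=\deg N_1+\deg N_2+1$. Let constant $\widehat K_i$ and polynomial $\widehat N_i$ be such that $\begin{bmatrix}K_i\\ \widehat K_i\end{bmatrix}$ is unimodular with inverse $\begin{bmatrix}\widehat N_i^T & N_i^T\end{bmatrix}$, $i=1,2$. For nonsingular $T,S$, $L(\lambda)=\begin{bmatrix}T(\lambda I_n-A)S & TB\widehat K_1 & 0\\ -\widehat K_2^TCS & M(\lambda) & K_2(\lambda)^T\\ 0 & K_1(\lambda) & 0\end{bmatrix}$. Right (left) minimal indices of a rational matrix $G$: degrees of the vectors of a minimal basis (polynomial basis of least total degree) of $\mathcal N_r(G)=\{x:Gx=0\}$ ($\mathcal N_\ell(G)=\{x:x^TG=0\}$). *)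

theory Defs
  imports "HOL-Computational_Algebra.Polynomial" "HOL-Computational_Algebra.Fraction_Field"
    "Jordan_Normal_Form.Matrix" "Jordan_Normal_Form.Determinant"
begin

definition rat_mat :: "'a::field poly mat \<Rightarrow> 'a poly fract mat" where
  "rat_mat P = map_mat to_fract P"

definition const_mat :: "'a::field mat \<Rightarrow> 'a poly mat" where
  "const_mat A = map_mat (\<lambda>c. [:c:]) A"

definition is_constant_mat :: "'a::field poly mat \<Rightarrow> bool" where
  "is_constant_mat P \<longleftrightarrow> (\<forall>i<dim_row P. \<forall>j<dim_col P. degree (P $$ (i,j)) = 0)"

definition char_pencil :: "'a::field mat \<Rightarrow> 'a poly mat" where
  "char_pencil A = [:0,1:] \<cdot>\<^sub>m 1\<^sub>m (dim_row A) - const_mat A"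

definition append_cols :: "'a::zero mat \<Rightarrow> 'a mat \<Rightarrow> 'a mat" where
  "append_cols A B = transpose_mat (transpose_mat A @\<^sub>r transpose_mat B)"

definition mat_degree :: "'a::zero poly mat \<Rightarrow> nat" where
  "mat_degree P = Max (insert 0 {degree (P $$ (i,j)) | i j. i < dim_row P \<and> j < dim_col P})"

definition row_degree :: "'a::zero poly mat \<Rightarrow> nat \<Rightarrow> nat" where
  "row_degree P i = Max (insert 0 {degree (P $$ (i,j)) | j. j < dim_col P})"

definition total_degree :: "'a::zero poly mat \<Rightarrow> nat" where
  "total_degree P = (\<Sum>i<dim_row P. row_degree P i)"

definition rows_indep :: "'a::idom fract mat \<Rightarrow> bool" where
  "rows_indep R \<longleftrightarrow> (\<forall>c \<in> carrier_vec (dim_row R). transpose_mat R *\<^sub>v c = 0\<^sub>v (dim_col R) \<longrightarrow> c = 0\<^sub>v (dim_row R))"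

definition row_space :: "'a::idom fract mat \<Rightarrow> 'a fract vec set" where
  "row_space R = {transpose_mat R *\<^sub>v c | c. c \<in> carrier_vec (dim_row R)}"

definition poly_basis_of :: "nat \<Rightarrow> 'a::field poly fract vec set \<Rightarrow> 'a poly mat \<Rightarrow> bool" where
  "poly_basis_of b V P \<longleftrightarrow> dim_col P = b \<and> rows_indep (rat_mat P) \<and> row_space (rat_mat P) = V"

definition minimal_basis_of :: "nat \<Rightarrow> 'a::field poly fract vec set \<Rightarrow> 'a poly mat \<Rightarrow> bool" where
  "minimal_basis_of b V P \<longleftrightarrow> poly_basis_of b V P \<and>
     (\<forall>Q. poly_basis_of b V Q \<longrightarrow> total_degree P \<le> total_degree Q)"

definition is_minimal_basis :: "'a::field poly mat \<Rightarrow> bool" where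
  "is_minimal_basis K \<longleftrightarrow> dim_row K < dim_col K \<and>
     minimal_basis_of (dim_col K) (row_space (rat_mat K)) K"

definition dual_minimal_bases :: "'a::field poly mat \<Rightarrow> 'a poly mat \<Rightarrow> bool" where
  "dual_minimal_bases K N \<longleftrightarrow> is_minimal_basis K \<and> is_minimal_basis N \<and>
     dim_col K = dim_col N \<and> dim_row K + dim_row N = dim_col K \<and>
     K * transpose_mat N = 0\<^sub>m (dim_row K) (dim_row N)"

definition right_null_space :: "'a::idom fract mat \<Rightarrow> 'a fract vec set" where
  "right_null_space G = {x \<in> carrier_vec (dim_col G). G *\<^sub>v x = 0\<^sub>v (dim_row G)}"

definition left_null_space :: "'a::idom fract mat \<Rightarrow> 'a fract vec set" where
  "left_null_space G = {x \<in> carrier_vec (dim_row G). transpose_mat G *\<^sub>v x = 0\<^sub>v (dim_col G)}"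

definition right_minimal_indices :: "'a::field poly fract mat \<Rightarrow> nat multiset \<Rightarrow> bool" where
  "right_minimal_indices G E \<longleftrightarrow> (\<exists>P. minimal_basis_of (dim_col G) (right_null_space G) P \<and>
      E = mset (map (row_degree P) [0..<dim_row P]))"

definition left_minimal_indices :: "'a::field poly fract mat \<Rightarrow> nat multiset \<Rightarrow> bool" where
  "left_minimal_indices G E \<longleftrightarrow> (\<exists>P. minimal_basis_of (dim_row G) (left_null_space G) P \<and>
      E = mset (map (row_degree P) [0..<dim_row P]))"

definition realizes :: "'a::field mat \<Rightarrow> 'a mat \<Rightarrow> 'a mat \<Rightarrow> 'a poly fract mat \<Rightarrow> bool" where
  "realizes A B C H \<longleftrightarrow> (\<exists>n p m. A \<in> carrier_mat n n \<and> B \<in> carrier_mat n m \<and> C \<in> carrier_mat p n \<and>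
     (\<exists>R \<in> carrier_mat n n. R * rat_mat (char_pencil A) = 1\<^sub>m n \<and> rat_mat (char_pencil A) * R = 1\<^sub>m n \<and>
        H = rat_mat (const_mat C) * R * rat_mat (const_mat B)))"

definition minimal_realization :: "'a::field mat \<Rightarrow> 'a mat \<Rightarrow> 'a mat \<Rightarrow> 'a poly fract mat \<Rightarrow> bool" where
  "minimal_realization A B C H \<longleftrightarrow> realizes A B C H \<and>
     (\<forall>A' B' C'. realizes A' B' C' H \<longrightarrow> dim_row A \<le> dim_row A')"

definition sbmb_lin :: "'a::field mat \<Rightarrow> 'a mat \<Rightarrow> 'a mat \<Rightarrow> 'a mat \<Rightarrow> 'a mat \<Rightarrow>
    'a poly mat \<Rightarrow> 'a poly mat \<Rightarrow> 'a poly mat \<Rightarrow> 'a poly mat \<Rightarrow> 'a poly mat \<Rightarrow> 'a poly mat" where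
  "sbmb_lin T S A B C M K1 K2 K1h K2h =
    (let n = dim_row A in
     append_cols (append_cols (const_mat T * char_pencil A * const_mat S) (const_mat T * const_mat B * K1h))
        (0\<^sub>m n (dim_row K2))
     @\<^sub>r append_cols (append_cols (- (transpose_mat K2h * const_mat C * const_mat S)) M) (transpose_mat K2)
     @\<^sub>r append_cols (append_cols (0\<^sub>m (dim_row K1) n) K1) (0\<^sub>m (dim_row K1) (dim_row K2)))"

end

(*
The null spaces of G and L over the field of rational functions are identified by
u |-> (- S^-1 (lambda I - A)^-1 B u, N1^T u, - N2h M N1^T u), with inverse (x, y, z) |-> K1h y.
The inverse is a polynomial matrix. The forward map sends polynomial vectors to polynomial
vectors because a minimal realization is observable: if x is rational and both (lambda I - A) x
and C x are polynomial, then x is polynomial. It raises degrees by exactly deg N1: the middle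
block does so by the predictable degree property of N1, and the equations L w = 0, together with
the predictable degree property of K2, bound the other two blocks. A degree-shifting isomorphism
carries bases of least total degree to bases of least total degree. Left minimal indices follow by
transposition, since L^T is the linearization built from A^T, -C^T, -B^T, M^T with the indices
1 and 2 swapped.
*)
theory Submission
  imports Defs "Jordan_Normal_Form.Char_Poly" "Subresultants.More_Homomorphisms"
begin

text \<open>Minimality of a realization is given only as least state dimension, so observability
  must be extracted by building a smaller system, the one induced on the quotient by the
  unobservable subspace. The field is arbitrary and may contain no eigenvalue of \<open>A\<close>;
  hence polynomiality of a state is obtained not from rank tests at points but from division with
  remainder by the determinant of the pencil. On the degree side the obstacle is \<open>N2h\<close>:
  nothing bounds its degree, so the explicit formula for the third block gives no estimate. That
  block is recovered from the second block row instead, where the row degree 1 of \<open>K2\<close>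
  offsets the degree 1 of the pencil \<open>M\<close>, and where the remaining term is controlled
  only because it is the output of a polynomial state of low degree. Minimal bases are compared
  through total degree alone. A shift by \<open>d\<close> in each row therefore helps only because
  all polynomial bases of one space have the same number r of rows, which makes every total degree
  change by the same amount \<open>r * d\<close>. For left indices no dual notion of observability
  is developed: least state dimension is itself invariant under transposition.\<close>

section \<open>Reduction modulo a subspace\<close>

text \<open>\<open>V\<close> and \<open>W\<close> factor the identity modulo \<open>U\<close>. For the least such \<open>r\<close>, \<open>W\<close> vanishes on
  \<open>U\<close>, so it presents the quotient by \<open>U\<close> without any choice of bases.\<close>

definition quotient_pair :: "'a::field vec set \<Rightarrow> nat \<Rightarrow> 'a mat \<Rightarrow> 'a mat \<Rightarrow> nat \<Rightarrow> bool" where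
  "quotient_pair U n W V r \<longleftrightarrow> W \<in> carrier_mat r n \<and> V \<in> carrier_mat n r \<and>
     (\<forall>x\<in>carrier_vec n. x - V *\<^sub>v (W *\<^sub>v x) \<in> U)"

lemma sum_insert_index:
  fixes f :: "nat \<Rightarrow> 'b::comm_monoid_add"
  assumes "j < Suc r" and "f j = 0"
  shows "(\<Sum>k\<in>{0..<r}. f (insert_index j k)) = (\<Sum>k\<in>{0..<Suc r}. f k)"
proof -
  have "(\<Sum>k\<in>{0..<Suc r}. f k) = (\<Sum>k\<in>{0..<Suc r} - {j}. f k)"
    using assms by (intro sum.mono_neutral_right) auto
  also have "{0..<Suc r} - {j} = insert_index j ` {0..<r}"
    using insert_index_image[of j r] assms by auto
  also have "(\<Sum>k\<in>\<dots>. f k) = (\<Sum>k\<in>{0..<r}. f (insert_index j k))"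
    using insert_index_inj_on by (subst sum.reindex) auto
  finally show ?thesis by simp
qed

lemma quotient_pair_reduce:
  fixes U :: "'a::field vec set"
  assumes qp: "quotient_pair U n W V r"
    and UV: "U \<subseteq> carrier_vec n"
    and Uadd: "\<And>x y. x \<in> U \<Longrightarrow> y \<in> U \<Longrightarrow> x + y \<in> U"
    and Usm: "\<And>a x. x \<in> U \<Longrightarrow> a \<cdot>\<^sub>v x \<in> U"
    and u: "u \<in> U" and Wu: "W *\<^sub>v u \<noteq> 0\<^sub>v r"
  shows "\<exists>W' V'. quotient_pair U n W' V' (r - 1) \<and> r > 0"
proof -
  from qp have W: "W \<in> carrier_mat r n" and V: "V \<in> carrier_mat n r"
    and q: "\<And>x. x \<in> carrier_vec n \<Longrightarrow> x - V *\<^sub>v (W *\<^sub>v x) \<in> U"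
    unfolding quotient_pair_def by auto
  have uc: "u \<in> carrier_vec n" using u UV by auto
  define z where "z = W *\<^sub>v u"
  have zc: "z \<in> carrier_vec r" using W uc by (auto simp: z_def)
  from Wu zc obtain j where j: "j < r" "z $ j \<noteq> 0"
    unfolding z_def[symmetric] by (metis carrier_vecD eq_vecI index_zero_vec(1,2))
  then obtain s where r: "r = Suc s" by (cases r) auto
  let ?i = "insert_index j"
  have ir: "?i k < r" if "k < s" for k using that by (auto simp: insert_index_def r)
  \<comment> \<open>\<open>W'\<close> first clears coordinate \<open>j\<close> with a multiple of
    \<open>z\<close> and then deletes it; \<open>V'\<close> drops the matching column of
    \<open>V\<close>.\<close>
  define V' where "V' = mat n s (\<lambda>(a,k). V $$ (a, ?i k))"
  define W' where "W' = mat s n (\<lambda>(k,b). W $$ (?i k, b) - z $ ?i k / z $ j * W $$ (j, b))"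
  have W'c: "W' \<in> carrier_mat s n" and V'c: "V' \<in> carrier_mat n s" by (auto simp: W'_def V'_def)
  have "x - V' *\<^sub>v (W' *\<^sub>v x) \<in> U" if x: "x \<in> carrier_vec n" for x
  proof -
    define t where "t = (W *\<^sub>v x) $ j / z $ j"
    define y where "y = W *\<^sub>v x - t \<cdot>\<^sub>v z"
    have Wx: "W *\<^sub>v x \<in> carrier_vec r" using W x by auto
    have yc: "y \<in> carrier_vec r" using Wx zc by (auto simp: y_def)
    have y0: "y $ j = 0" using j zc Wx by (simp add: y_def t_def)
    have W'x: "(W' *\<^sub>v x) $ k = y $ ?i k" if k: "k < s" for k
    proof -
      have "(W' *\<^sub>v x) $ k = (\<Sum>b\<in>{0..<n}. (W $$ (?i k, b) - z $ ?i k / z $ j * W $$ (j, b)) * x $ b)"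
        using k x by (simp add: W'_def scalar_prod_def)
      also have "\<dots> = (W *\<^sub>v x) $ ?i k - z $ ?i k / z $ j * (W *\<^sub>v x) $ j"
        using W x j ir[OF k] 
        by (simp add: scalar_prod_def left_diff_distrib sum_subtractf sum_distrib_left mult.assoc)
      also have "\<dots> = y $ ?i k"
        using ir[OF k] zc Wx by (simp add: y_def t_def)
      finally show ?thesis .
    qed
    have "V' *\<^sub>v (W' *\<^sub>v x) = V *\<^sub>v y"
    proof (rule eq_vecI)
      fix a assume "a < dim_vec (V *\<^sub>v y)"
      hence a: "a < n" using V by auto
      have "(V' *\<^sub>v (W' *\<^sub>v x)) $ a = (\<Sum>k\<in>{0..<s}. V $$ (a, ?i k) * y $ ?i k)"
        using a W'c x W'x by (simp add: V'_def scalar_prod_def)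
      also have "\<dots> = (\<Sum>k\<in>{0..<r}. V $$ (a, k) * y $ k)"
        using sum_insert_index[of j s "\<lambda>k. V $$ (a, k) * y $ k"] j y0 by (simp add: r)
      also have "\<dots> = (V *\<^sub>v y) $ a" using a V yc by (simp add: scalar_prod_def)
      finally show "(V' *\<^sub>v (W' *\<^sub>v x)) $ a = (V *\<^sub>v y) $ a" .
    qed (insert V V'c, auto)
    also have "\<dots> = V *\<^sub>v (W *\<^sub>v x) - t \<cdot>\<^sub>v (V *\<^sub>v z)"
      using V Wx zc by (simp add: y_def mult_minus_distrib_mat_vec[of _ n r] mult_mat_vec)
    \<comment> \<open>The correction \<open>t V z\<close> is rewritten through
      \<open>V z = u - (u - V (W u))\<close>, and both \<open>u\<close> and the bracket lie in
      \<open>U\<close>.\<close>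
    finally have "x - V' *\<^sub>v (W' *\<^sub>v x) = (x - V *\<^sub>v (W *\<^sub>v x)) + (- t) \<cdot>\<^sub>v (u - V *\<^sub>v (W *\<^sub>v u)) + t \<cdot>\<^sub>v u"
      using x uc V W zc Wx by (intro eq_vecI) (auto simp: z_def algebra_simps)
    also have "\<dots> \<in> U" using q[OF x] q[OF uc] u Uadd Usm by blast
    finally show ?thesis .
  qed
  thus ?thesis using W'c V'c r unfolding quotient_pair_def by auto
qed

text \<open>Descent from the identity pair with \<open>r = n\<close>. The nonzero \<open>v\<close>
  permits the first reduction and thereby the strict inequality; at the least r no further reduction
  is possible, which forces \<open>W\<close> to vanish on \<open>U\<close>.\<close>

lemma quotient_pair_exists:
  fixes U :: "'a::field vec set"
  assumes UV: "U \<subseteq> carrier_vec n" and U0: "0\<^sub>v n \<in> U"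
    and Uadd: "\<And>x y. x \<in> U \<Longrightarrow> y \<in> U \<Longrightarrow> x + y \<in> U"
    and Usm: "\<And>a x. x \<in> U \<Longrightarrow> a \<cdot>\<^sub>v x \<in> U"
    and v: "v \<in> U" "v \<noteq> 0\<^sub>v n"
  shows "\<exists>r W V. r < n \<and> quotient_pair U n W V r \<and> (\<forall>u\<in>U. W *\<^sub>v u = 0\<^sub>v r)"
proof -
  let ?ex = "\<lambda>r. \<exists>W V. quotient_pair U n W V r"
  have id: "quotient_pair U n (1\<^sub>m n) (1\<^sub>m n) n"
    using U0 by (auto simp: quotient_pair_def)
  have "\<exists>W' V'. quotient_pair U n W' V' (n - 1) \<and> n > 0"
    by (rule quotient_pair_reduce[OF id UV Uadd Usm v(1)]) (insert v UV, auto)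
  hence n: "?ex (n - 1)" "n > 0" by auto
  define r where "r = (LEAST r. ?ex r)"
  have r: "?ex r" unfolding r_def by (rule LeastI[of ?ex, OF n(1)])
  have "r \<le> n - 1" unfolding r_def by (rule Least_le[of ?ex, OF n(1)])
  with n(2) have rn: "r < n" by simp
  from r obtain W V where qp: "quotient_pair U n W V r" by auto
  have "W *\<^sub>v u = 0\<^sub>v r" if u: "u \<in> U" for u
  proof (rule ccontr)
    assume "W *\<^sub>v u \<noteq> 0\<^sub>v r"
    from quotient_pair_reduce[OF qp UV Uadd Usm u this] have "?ex (r - 1)" "r > 0" by auto
    with not_less_Least[of "r - 1" ?ex] show False unfolding r_def[symmetric] by auto
  qed
  with qp rn show ?thesis by blast
qed

section \<open>Minimal realizations are observable\<close>

lemma assoc_mult_mat_dim: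
  fixes X :: "'a::semiring_0 mat"
  shows "dim_col X = dim_row Y \<Longrightarrow> dim_col Y = dim_row Z \<Longrightarrow> X * Y * Z = X * (Y * Z)"
  by (rule assoc_mult_mat[of _ "dim_row X" "dim_col X" _ "dim_col Y" _ "dim_col Z"]) (auto intro: carrier_matI)

lemma assoc_mult_mat_vec_dim:
  fixes X :: "'a::semiring_0 mat"
  shows "dim_col X = dim_row Y \<Longrightarrow> dim_col Y = dim_vec v \<Longrightarrow> X * Y *\<^sub>v v = X *\<^sub>v (Y *\<^sub>v v)"
  by (rule assoc_mult_mat_vec[of _ "dim_row X" "dim_col X" _ "dim_col Y"]) (auto intro: carrier_matI carrier_vecI)

lemma transpose_mult_dim:
  fixes X :: "'a::comm_semiring_0 mat"
  shows "dim_col X = dim_row Y \<Longrightarrow> transpose_mat (X * Y) = transpose_mat Y * transpose_mat X"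
  by (rule transpose_mult[of _ "dim_row X" "dim_col X" _ "dim_col Y"]) (auto intro: carrier_matI)

lemma mult_minus_vec_dim:
  fixes X :: "'a::ring mat"
  shows "dim_col X = dim_vec u \<Longrightarrow> dim_vec v = dim_vec u \<Longrightarrow> X *\<^sub>v (u - v) = X *\<^sub>v u - X *\<^sub>v v"
  by (rule mult_minus_distrib_mat_vec[of _ "dim_row X" "dim_col X"]) (auto intro: carrier_matI carrier_vecI)

lemma mult_add_vec_dim:
  fixes X :: "'a::semiring_0 mat"
  shows "dim_col X = dim_vec u \<Longrightarrow> dim_vec v = dim_vec u \<Longrightarrow> X *\<^sub>v (u + v) = X *\<^sub>v u + X *\<^sub>v v"
  by (rule mult_add_distrib_mat_vec[of _ "dim_row X" "dim_col X"]) (auto intro: carrier_matI carrier_vecI)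

lemma mult_smult_vec_dim:
  fixes X :: "'a::comm_ring_1 mat"
  shows "dim_col X = dim_vec u \<Longrightarrow> X *\<^sub>v (a \<cdot>\<^sub>v u) = a \<cdot>\<^sub>v (X *\<^sub>v u)"
  by (intro eq_vecI) auto

lemma mult_uminus_vec_dim:
  fixes X :: "'a::ring mat"
  shows "dim_col X = dim_vec u \<Longrightarrow> X *\<^sub>v (- u) = - (X *\<^sub>v u)"
  by (intro eq_vecI) auto

lemma mult_mat_zero_vec: "X \<in> carrier_mat a b \<Longrightarrow> X *\<^sub>v 0\<^sub>v b = (0\<^sub>v a :: 'a::semiring_0 vec)"
  by (intro eq_vecI) auto

lemmas mat_dim_simps = assoc_mult_mat_dim assoc_mult_mat_vec_dim mult_minus_vec_dim mult_add_vec_dim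
  mult_smult_vec_dim mult_uminus_vec_dim

section \<open>Constant and polynomial matrices over the rational functions\<close>

abbreviation rat_vec :: "'a::field poly vec \<Rightarrow> 'a poly fract vec" where
  "rat_vec \<equiv> map_vec to_fract"

lemma rat_mat_carrier [simp]: "rat_mat P \<in> carrier_mat a b \<longleftrightarrow> P \<in> carrier_mat a b"
  by (auto simp: rat_mat_def)

lemma rat_mat_dim [simp]: "dim_row (rat_mat P) = dim_row P" "dim_col (rat_mat P) = dim_col P"
  by (auto simp: rat_mat_def)

lemma rat_mat_index [simp]: "i < dim_row P \<Longrightarrow> j < dim_col P \<Longrightarrow> rat_mat P $$ (i, j) = to_fract (P $$ (i, j))"
  by (auto simp: rat_mat_def)

lemma rat_mat_mult: "P \<in> carrier_mat a b \<Longrightarrow> Q \<in> carrier_mat b c \<Longrightarrow> rat_mat (P * Q) = rat_mat P * rat_mat Q"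
  unfolding rat_mat_def by (rule to_fract_hom.mat_hom_mult)

lemma rat_mat_mult_dim: "dim_col P = dim_row Q \<Longrightarrow> rat_mat (P * Q) = rat_mat P * rat_mat Q"
  by (rule rat_mat_mult[of _ "dim_row P" "dim_col P" _ "dim_col Q"]) (auto intro: carrier_matI)

lemma rat_mat_one [simp]: "rat_mat (1\<^sub>m n) = 1\<^sub>m n"
  unfolding rat_mat_def by (rule to_fract_hom.mat_hom_one)

lemma rat_mat_transpose: "rat_mat (transpose_mat P) = transpose_mat (rat_mat P)"
  by (simp add: rat_mat_def map_mat_transpose)

lemma rat_mat_uminus: "rat_mat (- P) = - rat_mat P"
  by (rule eq_matI) auto

lemma rat_mat_zero [simp]: "rat_mat (0\<^sub>m a b) = 0\<^sub>m a b"
  by (rule eq_matI) auto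

lemma rat_mat_mult_vec:
  "P \<in> carrier_mat a b \<Longrightarrow> u \<in> carrier_vec b \<Longrightarrow> rat_vec (P *\<^sub>v u) = rat_mat P *\<^sub>v rat_vec u"
  unfolding rat_mat_def by (rule to_fract_hom.mult_mat_vec_hom)

lemma det_rat_mat: "det (rat_mat P) = to_fract (det P)"
  unfolding rat_mat_def by simp

lemma const_mat_carrier [simp]: "const_mat P \<in> carrier_mat a b \<longleftrightarrow> P \<in> carrier_mat a b"
  by (auto simp: const_mat_def)

lemma const_mat_dim [simp]: "dim_row (const_mat P) = dim_row P" "dim_col (const_mat P) = dim_col P"
  by (auto simp: const_mat_def)

lemma const_mat_index [simp]: "i < dim_row P \<Longrightarrow> j < dim_col P \<Longrightarrow> const_mat P $$ (i, j) = [:P $$ (i, j):]"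
  by (auto simp: const_mat_def)

lemma const_mat_mult: "P \<in> carrier_mat a b \<Longrightarrow> Q \<in> carrier_mat b c \<Longrightarrow> const_mat (P * Q) = const_mat P * const_mat Q"
  unfolding const_mat_def by (rule coeff_lift_hom.mat_hom_mult)

lemma const_mat_one [simp]: "const_mat (1\<^sub>m n) = 1\<^sub>m n"
  unfolding const_mat_def by (rule coeff_lift_hom.mat_hom_one)

lemma const_mat_transpose: "const_mat (transpose_mat P) = transpose_mat (const_mat P)"
  by (simp add: const_mat_def map_mat_transpose)

lemma const_mat_uminus: "const_mat (- P) = - const_mat P"
  by (rule eq_matI) auto

lemma char_pencil_carrier [simp]: "A \<in> carrier_mat n n \<Longrightarrow> char_pencil A \<in> carrier_mat n n"
  by (auto simp: char_pencil_def)

lemma char_pencil_dim [simp]: "dim_row (char_pencil A) = dim_row A" "dim_col (char_pencil A) = dim_col A"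
  by (auto simp: char_pencil_def)

section \<open>The pencil of a state matrix and compression of realizations\<close>

lemma det_char_pencil:
  assumes A: "A \<in> carrier_mat n n"
  shows "det (char_pencil A) \<noteq> 0"
proof -
  have "char_pencil A = char_poly_matrix A"
    using A by (intro eq_matI) (auto simp: char_pencil_def char_poly_matrix_def)
  thus ?thesis using degree_monic_char_poly[OF A] by (auto simp: char_poly_def)
qed

lemma char_pencil_transpose:
  assumes A: "A \<in> carrier_mat n n"
  shows "char_pencil (transpose_mat A) = transpose_mat (char_pencil A)"
  using A by (intro eq_matI) (auto simp: char_pencil_def)

lemma char_pencil_mult_vec:
  assumes A: "A \<in> carrier_mat n n" and x: "x \<in> carrier_vec n"
  shows "char_pencil A *\<^sub>v x = [:0, 1:] \<cdot>\<^sub>v x - const_mat A *\<^sub>v x"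
proof -
  have "char_pencil A *\<^sub>v x = ([:0, 1:] \<cdot>\<^sub>m 1\<^sub>m n) *\<^sub>v x - const_mat A *\<^sub>v x"
    using A x unfolding char_pencil_def by (subst minus_mult_distrib_mat_vec[of _ n n]) auto
  also have "([:0, 1:] \<cdot>\<^sub>m 1\<^sub>m n) *\<^sub>v x = [:0, 1:] \<cdot>\<^sub>v x"
    using x by (intro eq_vecI) auto
  finally show ?thesis .
qed

lemma char_pencil_intertwine:
  assumes A: "A \<in> carrier_mat n n" and A': "A' \<in> carrier_mat r r" and W: "W \<in> carrier_mat r n"
    and WA: "W * A = A' * W"
  shows "const_mat W * char_pencil A = char_pencil A' * const_mat W"
proof -
  have "const_mat W * char_pencil A = [:0, 1:] \<cdot>\<^sub>m const_mat W - const_mat W * const_mat A"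
    using A W unfolding char_pencil_def
    by (simp add: mult_minus_distrib_mat[of _ r n _ n] mult_smult_distrib[of _ r n _ n])
  also have "\<dots> = [:0, 1:] \<cdot>\<^sub>m const_mat W - const_mat A' * const_mat W"
    using const_mat_mult[OF W A] const_mat_mult[OF A' W] WA by simp
  also have "\<dots> = char_pencil A' * const_mat W"
    using A' W unfolding char_pencil_def
    by (simp add: minus_mult_distrib_mat[of _ r r] mult_smult_assoc_mat[of _ r r _ n])
  finally show ?thesis .
qed

lemma mat_inverse_exists:
  fixes X :: "'a::field mat"
  assumes X: "X \<in> carrier_mat n n" and "det X \<noteq> 0"
  shows "\<exists>Y\<in>carrier_mat n n. X * Y = 1\<^sub>m n \<and> Y * X = 1\<^sub>m n"
  using det_non_zero_imp_unit[OF assms, of "()"] unfolding Units_def ring_mat_simps by auto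

text \<open>The relation \<open>W * A = A' * W\<close> passes to the pencils and from there to their
  inverses, \<open>W * R = R' * W\<close>. Hence
  \<open>C R B = C' W R B = C' R' (W B)\<close>.\<close>

lemma realizes_compress:
  assumes real: "realizes A B C H" and A: "A \<in> carrier_mat n n"
    and A': "A' \<in> carrier_mat r r" and W: "W \<in> carrier_mat r n" and C': "C' \<in> carrier_mat (dim_row C) r"
    and WA: "W * A = A' * W" and CW: "C = C' * W"
  shows "realizes A' (W * B) C' H"
proof -
  from real A obtain p m R where B: "B \<in> carrier_mat n m" and C: "C \<in> carrier_mat p n"
    and R: "R \<in> carrier_mat n n" "rat_mat (char_pencil A) * R = 1\<^sub>m n"
    and H: "H = rat_mat (const_mat C) * R * rat_mat (const_mat B)"
    unfolding realizes_def by auto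
  have C': "C' \<in> carrier_mat p r" using C C' by auto
  let ?P = "rat_mat (char_pencil A)" and ?P' = "rat_mat (char_pencil A')"
  let ?W = "rat_mat (const_mat W)"
  have P: "?P \<in> carrier_mat n n" and P': "?P' \<in> carrier_mat r r" and Wc: "?W \<in> carrier_mat r n"
    using A A' W by auto
  have "det ?P' \<noteq> 0" using det_char_pencil[OF A'] by (simp add: det_rat_mat)
  from mat_inverse_exists[OF P' this] obtain R' where R': "R' \<in> carrier_mat r r"
    "?P' * R' = 1\<^sub>m r" "R' * ?P' = 1\<^sub>m r" by auto
  have inter: "?W * ?P = ?P' * ?W"
    using arg_cong[OF char_pencil_intertwine[OF A A' W WA], of rat_mat] A A' W
    by (simp add: rat_mat_mult[of _ r n _ n] rat_mat_mult[of _ r r _ n])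
  have "?W * R = (R' * ?P') * (?W * R)" using R' Wc R by simp
  also have "\<dots> = R' * (?P' * (?W * R))" by (rule assoc_mult_mat[OF R'(1) P']) (use Wc R in auto)
  also have "?P' * (?W * R) = ?P' * ?W * R" by (rule assoc_mult_mat[OF P' Wc R(1), symmetric])
  also have "\<dots> = ?W * (?P * R)" unfolding inter[symmetric] by (rule assoc_mult_mat[OF Wc P R(1)])
  also have "\<dots> = ?W" using R Wc by simp
  finally have WR: "?W * R = R' * ?W" .
  let ?B = "rat_mat (const_mat B)" and ?C' = "rat_mat (const_mat C')"
  have Bc: "?B \<in> carrier_mat n m" and Cc: "?C' \<in> carrier_mat p r" using B C' by auto
  have "H = ?C' * ?W * R * ?B"
    unfolding H CW using C' W by (simp add: const_mat_mult[OF C' W] rat_mat_mult)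
  also have "\<dots> = ?C' * (?W * R) * ?B" using Cc Wc R by simp
  also have "\<dots> = ?C' * R' * (?W * ?B)" unfolding WR using Cc Wc R'(1) Bc by (simp add: mat_dim_simps)
  also have "?W * ?B = rat_mat (const_mat (W * B))"
    using B W by (simp add: const_mat_mult[OF W B] rat_mat_mult)
  finally have "H = ?C' * R' * rat_mat (const_mat (W * B))" .
  moreover have "W * B \<in> carrier_mat r m" using W B by simp
  ultimately show ?thesis unfolding realizes_def using A' C' R' by blast
qed

lemma mat_eq_by_vec:
  assumes "X \<in> carrier_mat a b" "Y \<in> carrier_mat a b"
    and "\<And>x. x \<in> carrier_vec b \<Longrightarrow> X *\<^sub>v x = Y *\<^sub>v (x::'a::comm_ring_1 vec)"
  shows "X = Y"
proof (rule eq_matI)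
  fix i j assume "i < dim_row Y" "j < dim_col Y"
  thus "X $$ (i, j) = Y $$ (i, j)"
    using arg_cong[OF assms(3)[of "unit_vec b j"], of "\<lambda>z. z $ i"] assms(1,2)
    by simp
qed (use assms in auto)

lemma vec_diff_zeroD:
  fixes x y :: "'a::ab_group_add vec"
  assumes "x \<in> carrier_vec n" "y \<in> carrier_vec n" and "x - y = 0\<^sub>v n"
  shows "x = y"
proof (rule eq_vecI)
  fix i assume "i < dim_vec y"
  thus "x $ i = y $ i" using assms(1,2) arg_cong[OF assms(3), of "\<lambda>z. z $ i"] by auto
qed (use assms in auto)

section \<open>Observability of minimal realizations\<close>

text \<open>Kalman's condition with all powers of \<open>A\<close> in place of those below the state
  dimension. In this form the unobservable subspace is visibly invariant under \<open>A\<close>,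
  with no appeal to Cayley-Hamilton.\<close>

definition observable :: "'a::field mat \<Rightarrow> 'a mat \<Rightarrow> bool" where
  "observable A C \<longleftrightarrow> (\<forall>v\<in>carrier_vec (dim_row A).
     (\<forall>k. (C * A ^\<^sub>m k) *\<^sub>v v = 0\<^sub>v (dim_row C)) \<longrightarrow> v = 0\<^sub>v (dim_row A))"

text \<open>The unobservable subspace \<open>U\<close> is invariant under \<open>A\<close> and lies
  in the kernel of \<open>C\<close>, so \<open>A\<close> and \<open>C\<close> descend to the
  quotient by \<open>U\<close> as \<open>W * A * V\<close> and \<open>C * V\<close>. If
  \<open>U\<close> is nonzero, the quotient system has fewer states and the same transfer
  function.\<close>

lemma minimal_realization_observable:
  assumes min: "minimal_realization A B C H"
    and A: "A \<in> carrier_mat n n" and C: "C \<in> carrier_mat p n"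
  shows "observable A C"
proof (rule ccontr)
  assume "\<not> observable A C"
  then obtain v where v: "v \<in> carrier_vec n" "\<And>k. (C * A ^\<^sub>m k) *\<^sub>v v = 0\<^sub>v p" "v \<noteq> 0\<^sub>v n"
    using A C unfolding observable_def by auto
  define U where "U = {x \<in> carrier_vec n. \<forall>k. (C * A ^\<^sub>m k) *\<^sub>v x = 0\<^sub>v p}"
  have CA: "C * A ^\<^sub>m k \<in> carrier_mat p n" for k using A C by auto
  have "\<exists>r W V. r < n \<and> quotient_pair U n W V r \<and> (\<forall>u\<in>U. W *\<^sub>v u = 0\<^sub>v r)"
  proof (rule quotient_pair_exists)
    show "x + y \<in> U" if "x \<in> U" "y \<in> U" for x y
      using that mult_add_distrib_mat_vec[OF CA] by (auto simp: U_def)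
    show "a \<cdot>\<^sub>v x \<in> U" if "x \<in> U" for a x
      using that mult_mat_vec[OF CA] by (auto simp: U_def)
    show "0\<^sub>v n \<in> U" using mult_mat_zero_vec[OF CA] by (simp add: U_def)
    show "v \<in> U" using v by (simp add: U_def)
  qed (use v in \<open>auto simp: U_def\<close>)
  then obtain r W V where r: "r < n" and qp: "quotient_pair U n W V r"
    and WU: "\<And>u. u \<in> U \<Longrightarrow> W *\<^sub>v u = 0\<^sub>v r" by auto
  from qp have W: "W \<in> carrier_mat r n" and V: "V \<in> carrier_mat n r"
    and q: "\<And>x. x \<in> carrier_vec n \<Longrightarrow> x - V *\<^sub>v (W *\<^sub>v x) \<in> U"
    unfolding quotient_pair_def by auto
  have AU: "A *\<^sub>v u \<in> U" if u: "u \<in> U" for u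
  proof -
    have uc: "u \<in> carrier_vec n" using u by (auto simp: U_def)
    have "(C * A ^\<^sub>m k) *\<^sub>v (A *\<^sub>v u) = 0\<^sub>v p" for k
    proof -
      have "(C * A ^\<^sub>m k) *\<^sub>v (A *\<^sub>v u) = (C * A ^\<^sub>m k * A) *\<^sub>v u"
        by (rule assoc_mult_mat_vec[OF CA A uc, symmetric])
      also have "C * A ^\<^sub>m k * A = C * A ^\<^sub>m Suc k"
        using assoc_mult_mat[OF C pow_carrier_mat[OF A, of k] A] by simp
      also have "\<dots> *\<^sub>v u = 0\<^sub>v p" using u unfolding U_def by blast
      finally show ?thesis .
    qed
    moreover have "A *\<^sub>v u \<in> carrier_vec n" using A uc by simp
    ultimately show ?thesis unfolding U_def by blast
  qed
  have CU: "C *\<^sub>v u = 0\<^sub>v p" if u: "u \<in> U" for u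
  proof -
    have "(C * A ^\<^sub>m 0) *\<^sub>v u = 0\<^sub>v p" using u unfolding U_def by blast
    thus ?thesis using A C by simp
  qed
  \<comment> \<open>\<open>x - V (W x)\<close> lies in \<open>U\<close>, where it stays under
    \<open>A\<close>, and \<open>W\<close> annihilates \<open>U\<close>.\<close>
  have WA: "W * A = W * A * V * W"
  proof (rule mat_eq_by_vec[of _ r n])
    fix x :: "'a vec" assume x: "x \<in> carrier_vec n"
    have "(W * A) *\<^sub>v x - (W * A * V * W) *\<^sub>v x = W *\<^sub>v (A *\<^sub>v (x - V *\<^sub>v (W *\<^sub>v x)))"
      using W A V x by (simp add: mat_dim_simps)
    also have "\<dots> = 0\<^sub>v r" using WU[OF AU[OF q[OF x]]] by simp
    finally have "(W * A) *\<^sub>v x - (W * A * V * W) *\<^sub>v x = 0\<^sub>v r" .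
    thus "(W * A) *\<^sub>v x = (W * A * V * W) *\<^sub>v x"
      by (rule vec_diff_zeroD[rotated 2]) (use W A V x in \<open>auto intro!: mult_mat_vec_carrier mult_carrier_mat simp del: assoc_mult_mat assoc_mult_mat_vec\<close>)
  qed (use W A V in auto)
  have CW: "C = (C * V) * W"
  proof (rule mat_eq_by_vec[of _ p n])
    fix x :: "'a vec" assume x: "x \<in> carrier_vec n"
    have "C *\<^sub>v x - ((C * V) * W) *\<^sub>v x = C *\<^sub>v (x - V *\<^sub>v (W *\<^sub>v x))"
      using W C V x by (simp add: mat_dim_simps)
    also have "\<dots> = 0\<^sub>v p" using CU[OF q[OF x]] by simp
    finally have "C *\<^sub>v x - ((C * V) * W) *\<^sub>v x = 0\<^sub>v p" .
    thus "C *\<^sub>v x = ((C * V) * W) *\<^sub>v x"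
      by (rule vec_diff_zeroD[rotated 2]) (use W C V x in \<open>auto intro!: mult_mat_vec_carrier mult_carrier_mat simp del: assoc_mult_mat assoc_mult_mat_vec\<close>)
  qed (use W C V in auto)
  have "realizes (W * A * V) (W * B) (C * V) H"
  proof (rule realizes_compress[OF _ A _ W _ WA CW])
    show "realizes A B C H" using min by (simp add: minimal_realization_def)
    show "W * A * V \<in> carrier_mat r r" "C * V \<in> carrier_mat (dim_row C) r" using W A V C by auto
  qed
  with min have "dim_row A \<le> dim_row (W * A * V)" unfolding minimal_realization_def by blast
  thus False using r A W V by auto
qed

section \<open>Transposition of realizations\<close>

text \<open>The two signs cancel in the transfer function. They are there because the blocks
  containing \<open>B\<close> and \<open>C\<close> carry opposite signs in the linearization and
  trade places under transposition.\<close>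

lemma realizes_transpose:
  assumes "realizes A B C H"
  shows "realizes (transpose_mat A) (- transpose_mat C) (- transpose_mat B) (transpose_mat H)"
proof -
  from assms obtain n p m R where A: "A \<in> carrier_mat n n" and B: "B \<in> carrier_mat n m" and C: "C \<in> carrier_mat p n"
    and R: "R \<in> carrier_mat n n" "R * rat_mat (char_pencil A) = 1\<^sub>m n" "rat_mat (char_pencil A) * R = 1\<^sub>m n"
    and H: "H = rat_mat (const_mat C) * R * rat_mat (const_mat B)"
    unfolding realizes_def by blast
  let ?t = transpose_mat
  let ?P = "rat_mat (char_pencil A)" and ?B = "rat_mat (const_mat B)" and ?C = "rat_mat (const_mat C)"
  have P: "?P \<in> carrier_mat n n" and Bc: "?B \<in> carrier_mat n m" and Cc: "?C \<in> carrier_mat p n" using A B C by auto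
  have "rat_mat (char_pencil (?t A)) = ?t ?P"
    by (simp add: char_pencil_transpose[OF A] rat_mat_transpose)
  moreover have "?t R * ?t ?P = 1\<^sub>m n" "?t ?P * ?t R = 1\<^sub>m n"
    using R P by (metis transpose_mult transpose_one)+
  moreover have "?t H = rat_mat (const_mat (- ?t B)) * ?t R * rat_mat (const_mat (- ?t C))"
    unfolding H const_mat_uminus rat_mat_uminus const_mat_transpose rat_mat_transpose
    using R(1) Bc Cc by (simp add: transpose_mult_dim assoc_mult_mat_dim)
  moreover have "?t A \<in> carrier_mat n n" "- ?t C \<in> carrier_mat n p" "- ?t B \<in> carrier_mat m n"
    "?t R \<in> carrier_mat n n" using A B C R by auto
  ultimately show ?thesis unfolding realizes_def
    by (intro exI[of _ n] exI[of _ m] exI[of _ p] conjI bexI[of _ "?t R"]) simp_all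
qed

text \<open>Any competitor for the transposed function transposes back, with the signs cancelling
  again, to a competitor for \<open>H\<close> with the same number of states.\<close>

lemma minimal_realization_transpose:
  assumes "minimal_realization A B C H"
  shows "minimal_realization (transpose_mat A) (- transpose_mat C) (- transpose_mat B) (transpose_mat H)"
  unfolding minimal_realization_def
proof (intro conjI allI impI)
  show "realizes (transpose_mat A) (- transpose_mat C) (- transpose_mat B) (transpose_mat H)"
    using assms realizes_transpose unfolding minimal_realization_def by blast
  fix A' B' C' assume r: "realizes A' B' C' (transpose_mat H)"
  have sq: "dim_col X = dim_row X" if "realizes X Y Z K" for X Y Z :: "'a mat" and K
    using that unfolding realizes_def by (elim exE conjE) simp
  have "realizes (transpose_mat A') (- transpose_mat C') (- transpose_mat B') H"
    using realizes_transpose[OF r] by simp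
  hence "dim_row A \<le> dim_row (transpose_mat A')"
    using assms unfolding minimal_realization_def by blast
  moreover have "dim_col A = dim_row A" using sq assms unfolding minimal_realization_def by blast
  ultimately show "dim_row (transpose_mat A) \<le> dim_row A'" using sq[OF r] by simp
qed

section \<open>Polynomial states\<close>

abbreviation coeff_vec :: "'a::zero poly vec \<Rightarrow> nat \<Rightarrow> 'a vec" where
  "coeff_vec s k \<equiv> map_vec (\<lambda>p. coeff p k) s"

lemma coeff_vec_const_mat_mult:
  assumes X: "X \<in> carrier_mat a n" and s: "s \<in> carrier_vec n"
  shows "coeff_vec (const_mat X *\<^sub>v s) k = X *\<^sub>v coeff_vec s k"
proof (rule eq_vecI)
  fix i assume "i < dim_vec (X *\<^sub>v coeff_vec s k)"
  thus "coeff_vec (const_mat X *\<^sub>v s) k $ i = (X *\<^sub>v coeff_vec s k) $ i"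
    using X s by (simp add: scalar_prod_def coeff_sum)
qed (use X in auto)

lemma multiple_low_degree_zero:
  fixes c g :: "'a::idom poly"
  assumes "c \<noteq> 0" and low: "\<And>k. degree c \<le> k \<Longrightarrow> coeff (c * g) k = 0"
  shows "g = 0"
proof (rule ccontr)
  assume "g \<noteq> 0"
  with \<open>c \<noteq> 0\<close> have "degree (c * g) \<ge> degree c" "c * g \<noteq> 0" by (auto simp: degree_mult_eq)
  with low[of "degree (c * g)"] show False by simp
qed

text \<open>If all entries of \<open>s\<close> have degree below that of \<open>c\<close>, then so have those of \<open>C A\<^sup>k s\<close>, which are
  multiples of \<open>c\<close> and hence vanish: every coefficient vector of \<open>s\<close> is unobservable.\<close>

lemma observable_low_degree_zero:
  assumes obs: "observable A C" and A: "A \<in> carrier_mat n n" and C: "C \<in> carrier_mat p n"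
    and c: "c \<noteq> 0" and s: "s \<in> carrier_vec n"
    and low: "\<And>k. degree c \<le> k \<Longrightarrow> coeff_vec s k = 0\<^sub>v n"
    and b: "b \<in> carrier_vec n" "char_pencil A *\<^sub>v s = c \<cdot>\<^sub>v b"
    and g: "g \<in> carrier_vec p" "const_mat C *\<^sub>v s = c \<cdot>\<^sub>v g"
  shows "s = 0\<^sub>v n"
proof -
  have zero: "const_mat X *\<^sub>v s = 0\<^sub>v q"
    if X: "X \<in> carrier_mat q n" and h: "h \<in> carrier_vec q" "const_mat X *\<^sub>v s = c \<cdot>\<^sub>v h" for X q h
  proof (rule eq_vecI)
    fix i assume "i < dim_vec (0\<^sub>v q :: 'a poly vec)"
    hence i: "i < q" by simp
    have "h $ i = 0"
    proof (rule multiple_low_degree_zero[OF c])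
      fix k assume "degree c \<le> k"
      have "coeff_vec (const_mat X *\<^sub>v s) k = 0\<^sub>v q"
        using low[OF \<open>degree c \<le> k\<close>] X by (simp add: coeff_vec_const_mat_mult[OF X s] mult_mat_zero_vec)
      from arg_cong[OF this, of "\<lambda>v. v $ i"] show "coeff (c * h $ i) k = 0"
        using h i by simp
    qed
    thus "(const_mat X *\<^sub>v s) $ i = 0\<^sub>v q $ i" using h i by simp
  qed (use X in simp)
  have CA: "C * A ^\<^sub>m k \<in> carrier_mat p n" for k using A C by auto
  \<comment> \<open>Modulo \<open>c\<close>, the matrix \<open>A\<close> acts on \<open>s\<close> as
    multiplication by the indeterminate. Once \<open>C A^k s\<close> vanishes,
    \<open>C A^(k+1) s\<close> is therefore a multiple of \<open>c\<close>, which is what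
    \<open>zero\<close> asks for.\<close>
  have As: "const_mat A *\<^sub>v s = [:0, 1:] \<cdot>\<^sub>v s - c \<cdot>\<^sub>v b"
    using b(2) A s b(1) by (simp add: char_pencil_mult_vec[OF A s] vec_eq_iff algebra_simps)
  have CAs: "const_mat (C * A ^\<^sub>m k) *\<^sub>v s = 0\<^sub>v p" for k
  proof (induction k)
    case 0
    show ?case using zero[OF C g] A C by simp
  next
    case (Suc k)
    let ?X = "const_mat (C * A ^\<^sub>m k)"
    have X: "?X \<in> carrier_mat p n" using CA by simp
    have "C * A ^\<^sub>m Suc k = (C * A ^\<^sub>m k) * A"
      using A C by (simp add: assoc_mult_mat_dim)
    hence "const_mat (C * A ^\<^sub>m Suc k) *\<^sub>v s = ?X *\<^sub>v (const_mat A *\<^sub>v s)"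
      using assoc_mult_mat_vec[OF X _ s, of "const_mat A"] A by (simp add: const_mat_mult[OF CA A])
    also have "\<dots> = [:0, 1:] \<cdot>\<^sub>v (?X *\<^sub>v s) - c \<cdot>\<^sub>v (?X *\<^sub>v b)"
      unfolding As using carrier_matD[OF X] s b by (simp add: mult_minus_vec_dim mult_smult_vec_dim)
    also have "\<dots> = c \<cdot>\<^sub>v (- (?X *\<^sub>v b))"
      unfolding Suc using carrier_matD[OF X] by (intro eq_vecI) auto
    finally show ?case
      by (intro zero[OF CA]) (use carrier_matD[OF X] in \<open>auto intro!: carrier_vecI\<close>)
  qed
  have "coeff_vec s j = 0\<^sub>v n" for j
  proof -
    have "(C * A ^\<^sub>m k) *\<^sub>v coeff_vec s j = 0\<^sub>v p" for k
      unfolding coeff_vec_const_mat_mult[OF CA s, symmetric] CAs by (intro eq_vecI) auto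
    moreover have "coeff_vec s j \<in> carrier_vec (dim_row A)" using s A by simp
    ultimately show ?thesis
      using obs unfolding observable_def carrier_matD[OF A] carrier_matD[OF C] by blast
  qed
  hence "coeff (s $ i) j = 0" if "i < n" for i j
    using that s by (metis carrier_vecD index_map_vec(1) index_zero_vec(1))
  thus ?thesis using s by (intro eq_vecI) (auto simp: poly_eq_iff)
qed

text \<open>Entrywise division by \<open>c\<close> leaves a remainder of degree below that of
  \<open>c\<close>. It satisfies the same two divisibility relations as \<open>y\<close>, because
  the quotient contributes only multiples of \<open>c\<close>; so the remainder vanishes.\<close>

lemma observable_divides:
  assumes obs: "observable A C" and A: "A \<in> carrier_mat n n" and C: "C \<in> carrier_mat p n"
    and c: "c \<noteq> 0" and y: "y \<in> carrier_vec n"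
    and b: "b \<in> carrier_vec n" "char_pencil A *\<^sub>v y = c \<cdot>\<^sub>v b"
    and g: "g \<in> carrier_vec p" "const_mat C *\<^sub>v y = c \<cdot>\<^sub>v g"
  shows "\<exists>q\<in>carrier_vec n. y = c \<cdot>\<^sub>v q"
proof -
  define q where "q = map_vec (\<lambda>f. f div c) y"
  define s where "s = map_vec (\<lambda>f. f mod c) y"
  have q: "q \<in> carrier_vec n" and s: "s \<in> carrier_vec n" using y by (auto simp: q_def s_def)
  have s': "s = y - c \<cdot>\<^sub>v q"
    using y by (intro eq_vecI) (auto simp: q_def s_def minus_mult_div_eq_mod)
  have "s = 0\<^sub>v n"
  proof (rule observable_low_degree_zero[OF obs A C c s])
    fix k assume k: "degree c \<le> k"
    have "coeff (f mod c) k = 0" for f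
      using degree_mod_less[OF c, of f] k by (auto intro: coeff_eq_0)
    thus "coeff_vec s k = 0\<^sub>v n" using y by (intro eq_vecI) (auto simp: s_def)
  next
    let ?P = "char_pencil A"
    have P: "?P \<in> carrier_mat n n" using A by simp
    show "?P *\<^sub>v s = c \<cdot>\<^sub>v (b - ?P *\<^sub>v q)"
      unfolding s' using carrier_matD[OF P] y q b
      by (simp add: mult_minus_vec_dim mult_smult_vec_dim vec_eq_iff right_diff_distrib)
    show "b - ?P *\<^sub>v q \<in> carrier_vec n" using carrier_matD[OF P] by (intro carrier_vecI) auto
    show "const_mat C *\<^sub>v s = c \<cdot>\<^sub>v (g - const_mat C *\<^sub>v q)"
      unfolding s' using C y q g
      by (simp add: mult_minus_vec_dim mult_smult_vec_dim vec_eq_iff right_diff_distrib)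
    show "g - const_mat C *\<^sub>v q \<in> carrier_vec p" using C by (intro carrier_vecI) auto
  qed
  hence "y - c \<cdot>\<^sub>v q = 0\<^sub>v n" using s' by simp
  hence "y = c \<cdot>\<^sub>v q" by (rule vec_diff_zeroD[rotated 2]) (use y q in simp_all)
  with q show ?thesis by blast
qed

lemma rat_vec_inj: "rat_vec u = rat_vec v \<Longrightarrow> u = v"
  by (rule to_fract_hom.vec_hom_inj)

text \<open>By Cramer's rule \<open>y = adj_mat (char_pencil A) f\<close> is polynomial and equals
  \<open>c\<close> times the state \<open>R f\<close>, where \<open>c\<close> is the determinant of
  the pencil. Both \<open>(\<lambda>I - A) y\<close> and \<open>C y\<close> are multiples of
  \<open>c\<close>, hence so is \<open>y\<close>, and the quotient is the state.\<close>

lemma observable_polynomial_state: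
  assumes obs: "observable A C" and A: "A \<in> carrier_mat n n" and C: "C \<in> carrier_mat p n"
    and R: "R \<in> carrier_mat n n" "R * rat_mat (char_pencil A) = 1\<^sub>m n"
    and f: "f \<in> carrier_vec n" and g: "g \<in> carrier_vec p"
    and CRf: "rat_mat (const_mat C) *\<^sub>v (R *\<^sub>v rat_vec f) = rat_vec g"
  shows "\<exists>q\<in>carrier_vec n. rat_vec q = R *\<^sub>v rat_vec f"
proof -
  let ?P = "char_pencil A"
  define c where "c = det ?P"
  have c: "c \<noteq> 0" using det_char_pencil[OF A] by (simp add: c_def)
  have P: "?P \<in> carrier_mat n n" using A by simp
  define y where "y = adj_mat ?P *\<^sub>v f"
  have y: "y \<in> carrier_vec n" using adj_mat(1)[OF P] f by (auto simp: y_def)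
  have Py: "?P *\<^sub>v y = c \<cdot>\<^sub>v f"
  proof -
    have "?P *\<^sub>v y = (?P * adj_mat ?P) *\<^sub>v f"
      unfolding y_def by (rule assoc_mult_mat_vec[OF P adj_mat(1)[OF P] f, symmetric])
    also have "\<dots> = c \<cdot>\<^sub>v f" unfolding adj_mat(2)[OF P] c_def using f by (intro eq_vecI) auto
    finally show ?thesis .
  qed
  have Rf: "R *\<^sub>v rat_vec f \<in> carrier_vec n" using R f by simp
  have ry: "rat_vec y = to_fract c \<cdot>\<^sub>v (R *\<^sub>v rat_vec f)"
  proof -
    have "rat_vec y = (R * rat_mat ?P) *\<^sub>v rat_vec y" unfolding R using y by simp
    also have "\<dots> = R *\<^sub>v rat_vec (?P *\<^sub>v y)"
      using assoc_mult_mat_vec[OF R(1), of "rat_mat ?P" n "rat_vec y"] P y by (simp add: rat_mat_mult_vec[OF P y])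
    also have "\<dots> = to_fract c \<cdot>\<^sub>v (R *\<^sub>v rat_vec f)"
      unfolding Py to_fract_hom.vec_hom_smult using R f by (simp add: mult_smult_vec_dim)
    finally show ?thesis .
  qed
  have "rat_vec (const_mat C *\<^sub>v y) = to_fract c \<cdot>\<^sub>v rat_vec g"
    unfolding CRf[symmetric] using C y Rf carrier_vecD[OF Rf]
    by (simp add: rat_mat_mult_vec[of _ p n] ry mult_smult_vec_dim)
  hence "const_mat C *\<^sub>v y = c \<cdot>\<^sub>v g"
    by (intro rat_vec_inj) (simp add: to_fract_hom.vec_hom_smult)
  from observable_divides[OF obs A C c y f Py g this]
  obtain q where q: "q \<in> carrier_vec n" "y = c \<cdot>\<^sub>v q" by auto
  from ry have "to_fract c \<cdot>\<^sub>v rat_vec q = to_fract c \<cdot>\<^sub>v (R *\<^sub>v rat_vec f)"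
    unfolding q(2) to_fract_hom.vec_hom_smult .
  hence "rat_vec q = R *\<^sub>v rat_vec f"
    using c q(1) carrier_vecD[OF Rf] by (simp add: vec_eq_iff)
  with q show ?thesis by blast
qed

section \<open>Degrees of polynomial vectors and minimal bases\<close>

text \<open>Shaped like \<open>row_degree\<close> so that both agree on rows. Zero and empty vectors
  receive degree 0, which is why the exact degree formulas below are restricted to nonzero
  vectors.\<close>

definition vec_degree :: "'a::zero poly vec \<Rightarrow> nat" where
  "vec_degree u = Max (insert 0 {degree (u $ j) | j. j < dim_vec u})"

lemma vec_degree_cong:
  "dim_vec u = dim_vec v \<Longrightarrow> (\<And>j. j < dim_vec v \<Longrightarrow> degree (u $ j) = degree (v $ j)) \<Longrightarrow> vec_degree u = vec_degree v"
  unfolding vec_degree_def by (rule arg_cong[of _ _ "\<lambda>S. Max (insert 0 S)"]) metis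

lemma vec_degree_le_iff: "vec_degree u \<le> d \<longleftrightarrow> (\<forall>j<dim_vec u. degree (u $ j) \<le> d)"
proof -
  have "finite {degree (u $ j) | j. j < dim_vec u}" by simp
  thus ?thesis unfolding vec_degree_def by (subst Max_le_iff) auto
qed

lemma degree_le_vec_degree: "j < dim_vec u \<Longrightarrow> degree (u $ j) \<le> vec_degree u"
  using vec_degree_le_iff[of u "vec_degree u"] by simp

lemma row_degree_eq_vec_degree: "i < dim_row P \<Longrightarrow> row_degree P i = vec_degree (row P i)"
  unfolding row_degree_def vec_degree_def
  by (rule arg_cong[of _ _ "\<lambda>S. Max (insert 0 S)"]) (simp, metis index_row(1))

lemma vec_degree_zero [simp]: "vec_degree (0\<^sub>v n) = 0"
  using vec_degree_le_iff[of "0\<^sub>v n" 0] by simp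

lemma vec_degree_uminus [simp]: "vec_degree (- u) = vec_degree (u :: 'a::ab_group_add poly vec)"
  by (rule vec_degree_cong) auto

lemma vec_degree_append: "vec_degree (u @\<^sub>v v) = max (vec_degree u) (vec_degree v)"
proof (rule antisym)
  show "vec_degree (u @\<^sub>v v) \<le> max (vec_degree u) (vec_degree v)"
    using degree_le_vec_degree[of _ u] degree_le_vec_degree[of _ v]
    unfolding vec_degree_le_iff by (auto simp: le_max_iff_disj)
  have "degree (u $ j) \<le> vec_degree (u @\<^sub>v v)" if "j < dim_vec u" for j
    using degree_le_vec_degree[of j "u @\<^sub>v v"] that by simp
  moreover have "degree (v $ j) \<le> vec_degree (u @\<^sub>v v)" if "j < dim_vec v" for j
    using degree_le_vec_degree[of "dim_vec u + j" "u @\<^sub>v v"] that by simp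
  ultimately show "max (vec_degree u) (vec_degree v) \<le> vec_degree (u @\<^sub>v v)"
    by (simp add: vec_degree_le_iff)
qed

lemma vec_degree_diff_le:
  fixes u v :: "'a::ab_group_add poly vec"
  shows "dim_vec u = dim_vec v \<Longrightarrow> vec_degree u \<le> d \<Longrightarrow> vec_degree v \<le> d \<Longrightarrow> vec_degree (u - v) \<le> d"
  unfolding vec_degree_le_iff by (auto intro: degree_diff_le)

lemma vec_degree_mult_le:
  fixes X :: "'a::comm_semiring_0 poly mat"
  assumes "dim_col X = dim_vec u"
    and deg: "\<And>i j. i < dim_row X \<Longrightarrow> j < dim_col X \<Longrightarrow> degree (X $$ (i, j)) \<le> d"
    and u: "vec_degree u \<le> e"
  shows "vec_degree (X *\<^sub>v u) \<le> d + e"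
  unfolding vec_degree_le_iff
proof (intro allI impI)
  fix i assume "i < dim_vec (X *\<^sub>v u)"
  hence i: "i < dim_row X" by simp
  have "degree (X $$ (i, j) * u $ j) \<le> d + e" if "j < dim_vec u" for j
    using degree_mult_le[of "X $$ (i, j)" "u $ j"] deg[OF i, of j] degree_le_vec_degree[OF that] u that assms(1)
    by linarith
  thus "degree ((X *\<^sub>v u) $ i) \<le> d + e"
    using i assms(1) by (auto simp: scalar_prod_def intro!: degree_sum_le)
qed

lemma coeff_vec_degree_nonzero:
  assumes u: "u \<in> carrier_vec n" "u \<noteq> 0\<^sub>v n"
  shows "coeff_vec u (vec_degree u) \<noteq> 0\<^sub>v n"
proof
  assume zero: "coeff_vec u (vec_degree u) = 0\<^sub>v n"
  from u obtain j where j: "j < n" "u $ j \<noteq> 0"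
    by (metis carrier_vecD eq_vecI index_zero_vec(1,2))
  have lead: "coeff (u $ i) (vec_degree u) = 0" if "i < n" for i
    using arg_cong[OF zero, of "\<lambda>v. v $ i"] that u by simp
  let ?S = "{degree (u $ j) | j. j < dim_vec u}"
  \<comment> \<open>The maximum may be the default 0, or be attained at an entry that is itself
    zero. In either case all entries of \<open>u\<close> are constants, and the vanishing
    coefficients are the entries themselves.\<close>
  have "vec_degree u \<in> insert 0 ?S" unfolding vec_degree_def by (rule Max_in) auto
  then show False
  proof
    assume 0: "vec_degree u = 0"
    hence "degree (u $ j) = 0" using degree_le_vec_degree[of j u] j u by simp
    with lead[OF j(1)] 0 j(2) show False by (metis leading_coeff_0_iff)
  next
    assume "vec_degree u \<in> ?S"
    then obtain i where i: "i < n" "vec_degree u = degree (u $ i)" using u by auto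
    hence "u $ i = 0" using lead[OF i(1)] by simp
    hence "vec_degree u = 0" using i by simp
    hence "degree (u $ j) = 0" using degree_le_vec_degree[of j u] j u by simp
    with lead[OF j(1)] \<open>vec_degree u = 0\<close> j(2) show False by (metis leading_coeff_0_iff)
  qed
qed

text \<open>Stated with upper bounds on the degrees, so that entries below the maximal degree are
  covered too: for them both sides are 0.\<close>

lemma coeff_mult_top:
  fixes f g :: "'a::idom poly"
  assumes "degree f \<le> d" "degree g \<le> e"
  shows "coeff (f * g) (d + e) = coeff f d * coeff g e"
proof (cases "degree f = d \<and> degree g = e")
  case True
  thus ?thesis using coeff_mult_degree_sum[of f g] by simp
next
  case False
  hence "degree (f * g) < d + e" using degree_mult_le[of f g] assms by linarith
  moreover from False assms have "degree f < d \<or> degree g < e" by linarith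
  ultimately show ?thesis by (auto simp: coeff_eq_0)
qed

section \<open>Leading coefficients of minimal bases\<close>

lemma poly_basis_of_change:
  assumes P: "poly_basis_of b V P" and a: "dim_row P = a"
    and X: "X \<in> carrier_mat a a" and Y: "Y \<in> carrier_mat a a"
    and XY: "X * Y = 1\<^sub>m a" "Y * X = 1\<^sub>m a"
    and Q: "rat_mat Q = X * rat_mat P"
  shows "poly_basis_of b V Q"
proof -
  let ?t = transpose_mat
  have b: "dim_col P = b" and ind: "rows_indep (rat_mat P)" and V: "row_space (rat_mat P) = V"
    using P by (auto simp: poly_basis_of_def)
  have Pc: "rat_mat P \<in> carrier_mat a b" using a b by (intro carrier_matI) simp_all
  have dQ: "dim_row Q = a" "dim_col Q = b"
    using arg_cong[OF Q, of dim_row] arg_cong[OF Q, of dim_col] X b by auto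
  have Qt: "?t (rat_mat Q) *\<^sub>v c = ?t (rat_mat P) *\<^sub>v (?t X *\<^sub>v c)" if "c \<in> carrier_vec a" for c
    unfolding Q using X Pc that by (simp add: transpose_mult_dim assoc_mult_mat_vec_dim)
  have inv1: "?t Y *\<^sub>v (?t X *\<^sub>v c) = c" and inv2: "?t X *\<^sub>v (?t Y *\<^sub>v c) = c"
    if "c \<in> carrier_vec a" for c
    using arg_cong[OF XY(1), of ?t] arg_cong[OF XY(2), of ?t] X Y that
    by (simp_all add: transpose_mult_dim assoc_mult_mat_vec_dim[symmetric])
  have Xc: "?t X *\<^sub>v c \<in> carrier_vec a" and Yc: "?t Y *\<^sub>v c \<in> carrier_vec a" for c
    using X Y by (auto intro!: carrier_vecI)
  have "rows_indep (rat_mat Q)"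
    unfolding rows_indep_def rat_mat_dim dQ
  proof (intro ballI impI)
    fix c :: "'a poly fract vec" assume c: "c \<in> carrier_vec a" "?t (rat_mat Q) *\<^sub>v c = 0\<^sub>v b"
    hence "?t X *\<^sub>v c = 0\<^sub>v a"
      using ind Xc unfolding rows_indep_def rat_mat_dim a b by (simp add: Qt)
    from arg_cong[OF this, of "\<lambda>z. ?t Y *\<^sub>v z"] show "c = 0\<^sub>v a"
      using inv1[OF c(1)] Y by (simp add: mult_mat_zero_vec[of _ a a])
  qed
  moreover have "row_space (rat_mat Q) = row_space (rat_mat P)"
    unfolding row_space_def rat_mat_dim dQ a
  proof (intro equalityI subsetI; elim CollectE exE conjE; intro CollectI)
    fix x c assume "x = ?t (rat_mat Q) *\<^sub>v c" and c: "c \<in> carrier_vec a"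
    thus "\<exists>c. x = ?t (rat_mat P) *\<^sub>v c \<and> c \<in> carrier_vec a" using Qt[OF c] Xc by blast
  next
    fix x c assume "x = ?t (rat_mat P) *\<^sub>v c" and c: "c \<in> carrier_vec a"
    hence "x = ?t (rat_mat Q) *\<^sub>v (?t Y *\<^sub>v c)" by (simp only: Qt[OF Yc] inv2[OF c])
    thus "\<exists>c. x = ?t (rat_mat Q) *\<^sub>v c \<and> c \<in> carrier_vec a" using Yc by blast
  qed
  ultimately show ?thesis using V dQ by (simp add: poly_basis_of_def)
qed

text \<open>A dependency between the leading coefficient rows would allow replacing a row by a combination
  of lower degree.\<close>

lemma minimal_basis_leading_coeffs_indep:
  assumes min: "minimal_basis_of b V N" and N: "N \<in> carrier_mat a b"
    and deg: "\<And>i. i < a \<Longrightarrow> row_degree N i = d"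
    and c: "c \<in> carrier_vec a" "c \<noteq> 0\<^sub>v a"
  shows "transpose_mat (map_mat (\<lambda>f. coeff f d) N) *\<^sub>v c \<noteq> 0\<^sub>v b"
proof
  assume zero: "transpose_mat (map_mat (\<lambda>f. coeff f d) N) *\<^sub>v c = 0\<^sub>v b"
  from c obtain i0 where i0: "i0 < a" "c $ i0 \<noteq> 0"
    by (metis carrier_vecD eq_vecI index_zero_vec(1,2))
  \<comment> \<open>The identity matrix with row \<open>i0\<close> replaced by \<open>c\<close>. It
    is invertible because \<open>c $ i0\<close> is nonzero, and it replaces row \<open>i0\<close> of
    \<open>N\<close> by the combination whose coefficients at degree \<open>d\<close>
    cancel.\<close>
  define E where "E = mat a a (\<lambda>(i, k). if i = i0 then c $ k else if k = i then 1 else 0)"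
  have E: "E \<in> carrier_mat a a" by (simp add: E_def)
  have "det E \<noteq> 0"
  proof
    assume "det E = 0"
    then obtain v where v: "v \<in> carrier_vec a" "v \<noteq> 0\<^sub>v a" "E *\<^sub>v v = 0\<^sub>v a"
      using det_0_iff_vec_prod_zero_field[OF E] by blast
    have Ev: "(\<Sum>k\<in>{0..<a}. E $$ (i, k) * v $ k) = 0" if "i < a" for i
      using arg_cong[OF v(3), of "\<lambda>z. z $ i"] that v(1) E by (simp add: scalar_prod_def)
    have off: "v $ i = 0" if i: "i < a" "i \<noteq> i0" for i
    proof -
      have "(\<Sum>k\<in>{0..<a}. E $$ (i, k) * v $ k) = (\<Sum>k\<in>{0..<a}. if k = i then v $ k else 0)"
        using i by (intro sum.cong) (auto simp: E_def)
      thus ?thesis using Ev[OF i(1)] i by simp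
    qed
    have "(\<Sum>k\<in>{0..<a}. E $$ (i0, k) * v $ k) = (\<Sum>k\<in>{0..<a}. if k = i0 then c $ i0 * v $ i0 else 0)"
      using i0 off by (intro sum.cong) (auto simp: E_def)
    hence "v $ i0 = 0" using Ev[OF i0(1)] i0 by simp
    with off have "v $ i = 0" if "i < a" for i using that by (cases "i = i0") auto
    hence "v = 0\<^sub>v a" using v(1) by (intro eq_vecI) auto
    with v show False by simp
  qed
  from mat_inverse_exists[OF E this] obtain E' where E': "E' \<in> carrier_mat a a" "E * E' = 1\<^sub>m a" "E' * E = 1\<^sub>m a"
    by blast
  define N' where "N' = const_mat E * N"
  have N': "N' \<in> carrier_mat a b" using E N by (auto simp: N'_def)
  have basis: "poly_basis_of b V N'"
  proof (rule poly_basis_of_change)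
    show "poly_basis_of b V N" using min by (simp add: minimal_basis_of_def)
    show "rat_mat N' = rat_mat (const_mat E) * rat_mat N"
      using E N by (simp add: N'_def rat_mat_mult[of _ a a])
    show "rat_mat (const_mat E) * rat_mat (const_mat E') = 1\<^sub>m a"
      "rat_mat (const_mat E') * rat_mat (const_mat E) = 1\<^sub>m a"
      using E E' by (simp_all add: rat_mat_mult[of _ a a _ a, symmetric] const_mat_mult[of _ a a _ a, symmetric])
  qed (use E E' N in auto)
  have N'i0: "N' $$ (i0, j) = (\<Sum>k\<in>{0..<a}. smult (c $ k) (N $$ (k, j)))" if "j < b" for j
    using that i0 E N by (simp add: N'_def E_def scalar_prod_def)
  have N'i: "N' $$ (i, j) = N $$ (i, j)" if i: "i < a" "i \<noteq> i0" and j: "j < b" for i j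
  proof -
    have "N' $$ (i, j) = (\<Sum>k\<in>{0..<a}. [:E $$ (i, k):] * N $$ (k, j))"
      using i j E N by (simp add: N'_def scalar_prod_def)
    also have "\<dots> = (\<Sum>k\<in>{0..<a}. if k = i then N $$ (k, j) else 0)"
      using i by (intro sum.cong) (auto simp: E_def)
    finally show ?thesis using i by simp
  qed
  have entry: "degree (N $$ (i, j)) \<le> d" if "i < a" "j < b" for i j
    using degree_le_vec_degree[of j "row N i"] deg[of i] that N by (simp add: row_degree_eq_vec_degree)
  have low: "degree (N' $$ (i0, j)) \<le> d" "coeff (N' $$ (i0, j)) d = 0" if j: "j < b" for j
  proof -
    show "degree (N' $$ (i0, j)) \<le> d"
      unfolding N'i0[OF j] using entry j by (intro degree_sum_le) (auto intro: order.trans[OF degree_smult_le])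
    show "coeff (N' $$ (i0, j)) d = 0"
      using arg_cong[OF zero, of "\<lambda>z. z $ j"] j N c(1)
      by (simp add: N'i0 coeff_sum scalar_prod_def mult.commute)
  qed
  have rows: "row_degree N' i = row_degree N i" if "i < a" "i \<noteq> i0" for i
    using that N N' by (simp add: row_degree_eq_vec_degree) (rule vec_degree_cong, auto simp: N'i)
  show False
  \<comment> \<open>For \<open>d = 0\<close> no lower degree exists; then the new row is zero,
    against independence. For positive \<open>d\<close> its degree drops strictly while the other
    rows keep theirs, against minimality.\<close>
  proof (cases "d = 0")
    case True
    have "N' $$ (i0, j) = 0" if "j < b" for j
      using low[OF that] True by (metis leading_coeff_0_iff le_zero_eq)
    hence "transpose_mat (rat_mat N') *\<^sub>v unit_vec a i0 = 0\<^sub>v b"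
      using N' i0 by (intro eq_vecI) auto
    moreover have "rows_indep (rat_mat N')" using basis by (simp add: poly_basis_of_def)
    ultimately have "unit_vec a i0 = (0\<^sub>v a :: 'a poly fract vec)"
      using N' unfolding rows_indep_def by auto
    from arg_cong[OF this, of "\<lambda>z. z $ i0"] show False using i0 by simp
  next
    case False
    have "degree (N' $$ (i0, j)) \<le> d - 1" if "j < b" for j
      using low[OF that] False eq_zero_or_degree_less[of "N' $$ (i0, j)" d] by auto
    hence "row_degree N' i0 \<le> d - 1"
      using N' i0 by (simp add: row_degree_eq_vec_degree vec_degree_le_iff)
    hence "row_degree N' i0 < row_degree N i0" using False deg[OF i0(1)] by simp
    hence "(\<Sum>i<a. row_degree N' i) < (\<Sum>i<a. row_degree N i)"
    proof (intro sum_strict_mono_ex1 ballI)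
      fix i assume "i \<in> {..<a}"
      thus "row_degree N' i \<le> row_degree N i"
        using rows[of i] \<open>row_degree N' i0 < row_degree N i0\<close> by (cases "i = i0") auto
    qed (use i0 \<open>row_degree N' i0 < row_degree N i0\<close> in auto)
    hence "total_degree N' < total_degree N" using N N' by (simp add: total_degree_def)
    with min basis show False unfolding minimal_basis_of_def by (meson not_less)
  qed
qed

text \<open>Forney's predictable degree property in the case of equal row degrees. There the
  coefficient at \<open>d + vec_degree u\<close> is the leading coefficient matrix applied to the
  leading coefficient vector of \<open>u\<close>, and independence of the leading rows prevents
  cancellation.\<close>

lemma minimal_basis_predictable_degree:
  assumes min: "minimal_basis_of b V N" and N: "N \<in> carrier_mat a b"
    and deg: "\<And>i. i < a \<Longrightarrow> row_degree N i = d"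
    and u: "u \<in> carrier_vec a" "u \<noteq> 0\<^sub>v a"
  shows "vec_degree (transpose_mat N *\<^sub>v u) = vec_degree u + d"
proof (rule antisym)
  let ?e = "vec_degree u"
  have entry: "degree (N $$ (i, j)) \<le> d" if "i < a" "j < b" for i j
    using degree_le_vec_degree[of j "row N i"] deg[of i] that N by (simp add: row_degree_eq_vec_degree)
  have "vec_degree (transpose_mat N *\<^sub>v u) \<le> d + ?e"
    by (rule vec_degree_mult_le) (use N u entry in auto)
  thus "vec_degree (transpose_mat N *\<^sub>v u) \<le> ?e + d" by simp
  have ue: "degree (u $ i) \<le> ?e" if "i < a" for i using degree_le_vec_degree[of i u] that u by simp
  have "coeff_vec (transpose_mat N *\<^sub>v u) (d + ?e) = transpose_mat (map_mat (\<lambda>f. coeff f d) N) *\<^sub>v coeff_vec u ?e"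
    using N u(1) entry ue by (intro eq_vecI) (auto simp: scalar_prod_def coeff_sum coeff_mult_top intro!: sum.cong)
  also have "\<dots> \<noteq> 0\<^sub>v b"
    by (rule minimal_basis_leading_coeffs_indep[OF min N deg]) (use coeff_vec_degree_nonzero[OF u] u in auto)
  finally have "coeff_vec (transpose_mat N *\<^sub>v u) (d + ?e) \<noteq> 0\<^sub>v b" .
  then obtain j where j: "j < b" "coeff ((transpose_mat N *\<^sub>v u) $ j) (d + ?e) \<noteq> 0"
    using N by (auto simp: vec_eq_iff)
  hence "d + ?e \<le> degree ((transpose_mat N *\<^sub>v u) $ j)" by (intro le_degree)
  also have "\<dots> \<le> vec_degree (transpose_mat N *\<^sub>v u)" by (rule degree_le_vec_degree) (use N j in simp)
  finally show "?e + d \<le> vec_degree (transpose_mat N *\<^sub>v u)" by simp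
qed

lemma mat_degree_le_iff:
  "mat_degree N \<le> d \<longleftrightarrow> (\<forall>i<dim_row N. \<forall>j<dim_col N. degree (N $$ (i, j)) \<le> d)"
proof -
  let ?S = "{degree (N $$ (i, j)) | i j. i < dim_row N \<and> j < dim_col N}"
  have "?S = (\<lambda>(i, j). degree (N $$ (i, j))) ` ({..<dim_row N} \<times> {..<dim_col N})" by auto
  hence "finite ?S" by simp
  thus ?thesis unfolding mat_degree_def by (subst Max_le_iff) auto
qed

lemma degree_le_mat_degree: "i < dim_row N \<Longrightarrow> j < dim_col N \<Longrightarrow> degree (N $$ (i, j)) \<le> mat_degree N"
  using mat_degree_le_iff[of N "mat_degree N"] by simp

lemma mat_degree_transpose: "mat_degree (transpose_mat N) = mat_degree N"
proof -
  have le: "mat_degree X \<le> mat_degree (transpose_mat X)" for X :: "'a poly mat"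
    unfolding mat_degree_le_iff
  proof (intro allI impI)
    fix i j assume "i < dim_row X" "j < dim_col X"
    thus "degree (X $$ (i, j)) \<le> mat_degree (transpose_mat X)"
      using degree_le_mat_degree[of j "transpose_mat X" i] by simp
  qed
  show ?thesis using le[of N] le[of "transpose_mat N"] by simp
qed

lemma mat_degree_eq_row_degree:
  assumes N: "N \<in> carrier_mat a b" and a: "a > 0"
    and deg: "\<And>i. i < a \<Longrightarrow> row_degree N i = d"
  shows "mat_degree N = d"
proof (rule antisym)
  show "mat_degree N \<le> d"
    unfolding mat_degree_le_iff
  proof (intro allI impI)
    fix i j assume "i < dim_row N" "j < dim_col N"
    thus "degree (N $$ (i, j)) \<le> d"
      using degree_le_vec_degree[of j "row N i"] deg[of i] N by (simp add: row_degree_eq_vec_degree)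
  qed
  have "vec_degree (row N 0) \<le> mat_degree N"
    using N a degree_le_mat_degree[of 0 N] by (simp add: vec_degree_le_iff)
  thus "d \<le> mat_degree N" using deg[OF a] N a by (simp add: row_degree_eq_vec_degree)
qed

section \<open>Transport of minimal bases\<close>

text \<open>If r were smaller than s, padding with zeros to square size would keep
  \<open>X' * Y' = 1\<close>. One-sided inverses of square matrices are two-sided, yet the padded
  row r of \<open>Y' * X'\<close> is zero.\<close>

lemma mat_right_inverse_dim_le:
  fixes X Y :: "'a::field mat"
  assumes X: "X \<in> carrier_mat s r" and Y: "Y \<in> carrier_mat r s" and XY: "X * Y = 1\<^sub>m s"
  shows "s \<le> r"
proof (rule ccontr)
  assume "\<not> s \<le> r"
  hence rs: "r < s" by simp
  define X' where "X' = mat s s (\<lambda>(i, j). if j < r then X $$ (i, j) else 0)"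
  define Y' where "Y' = mat s s (\<lambda>(i, j). if i < r then Y $$ (i, j) else 0)"
  have X': "X' \<in> carrier_mat s s" and Y': "Y' \<in> carrier_mat s s" by (auto simp: X'_def Y'_def)
  have "X' * Y' = 1\<^sub>m s"
  proof (rule eq_matI)
    fix i j assume "i < dim_row (1\<^sub>m s :: 'a mat)" "j < dim_col (1\<^sub>m s :: 'a mat)"
    hence ij: "i < s" "j < s" by auto
    have "(X' * Y') $$ (i, j) = (\<Sum>k\<in>{0..<s}. X' $$ (i, k) * Y' $$ (k, j))"
      using ij X' Y' by (simp add: scalar_prod_def)
    also have "\<dots> = (\<Sum>k\<in>{0..<r}. X $$ (i, k) * Y $$ (k, j))"
      using ij rs by (intro sum.mono_neutral_cong_right) (auto simp: X'_def Y'_def)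
    also have "\<dots> = (X * Y) $$ (i, j)" using ij X Y by (simp add: scalar_prod_def)
    finally show "(X' * Y') $$ (i, j) = 1\<^sub>m s $$ (i, j)" using XY by simp
  qed (use X' Y' in auto)
  hence Y'X': "Y' * X' = 1\<^sub>m s" by (rule mat_mult_left_right_inverse[OF X' Y'])
  have "(Y' * X') $$ (r, r) = 0"
    using rs X' Y' by (simp add: scalar_prod_def Y'_def)
  with Y'X' rs show False by simp
qed

lemma row_space_subset_factor:
  fixes P Q :: "'a::idom fract mat"
  assumes P: "P \<in> carrier_mat r b" and Q: "Q \<in> carrier_mat s b"
    and sub: "row_space P \<subseteq> row_space Q"
  shows "\<exists>X\<in>carrier_mat s r. transpose_mat P = transpose_mat Q * X"
proof -
  have "\<exists>c\<in>carrier_vec s. row P i = transpose_mat Q *\<^sub>v c" if i: "i < r" for i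
  proof -
    have "row P i = transpose_mat P *\<^sub>v unit_vec r i"
      using i P by (intro eq_vecI) auto
    hence "row P i \<in> row_space P" unfolding row_space_def using P by auto
    with sub Q show ?thesis unfolding row_space_def by auto
  qed
  then obtain c where c: "\<And>i. i < r \<Longrightarrow> c i \<in> carrier_vec s"
    "\<And>i. i < r \<Longrightarrow> row P i = transpose_mat Q *\<^sub>v c i" by metis
  let ?X = "mat s r (\<lambda>(k, i). c i $ k)"
  have "transpose_mat P = transpose_mat Q * ?X"
  proof (rule eq_matI)
    fix j i assume "j < dim_row (transpose_mat Q * ?X)" "i < dim_col (transpose_mat Q * ?X)"
    hence ij: "j < b" "i < r" using Q by auto
    have "col ?X i = c i" using c(1)[OF ij(2)] ij by (intro eq_vecI) auto
    thus "transpose_mat P $$ (j, i) = (transpose_mat Q * ?X) $$ (j, i)"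
      using arg_cong[OF c(2)[OF ij(2)], of "\<lambda>v. v $ j"] ij P Q by simp
  qed (use P Q in auto)
  thus ?thesis by (intro bexI[of _ ?X]) auto
qed

text \<open>Expressing the rows of \<open>P\<close> by those of \<open>Q\<close> and back gives
  coefficient matrices whose product fixes every vector, by independence of the rows of
  \<open>P\<close>; a right inverse then bounds the sizes.\<close>

lemma rows_indep_dim_le:
  fixes P Q :: "'a::idom fract mat"
  assumes P: "P \<in> carrier_mat r b" and Q: "Q \<in> carrier_mat s b"
    and ind: "rows_indep P" and eq: "row_space P = row_space Q"
  shows "r \<le> s"
proof -
  let ?t = transpose_mat
  obtain X where X: "X \<in> carrier_mat s r" "?t P = ?t Q * X"
    using row_space_subset_factor[OF P Q] eq by auto
  obtain Y where Y: "Y \<in> carrier_mat r s" "?t Q = ?t P * Y"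
    using row_space_subset_factor[OF Q P] eq by auto
  have "Y * X = 1\<^sub>m r"
  proof (rule mat_eq_by_vec[of _ r r])
    fix x :: "'a fract vec" assume x: "x \<in> carrier_vec r"
    have YXx: "Y *\<^sub>v (X *\<^sub>v x) \<in> carrier_vec r" using X Y x by (metis mult_mat_vec_carrier)
    have "?t P *\<^sub>v x = (?t Q * X) *\<^sub>v x" using X(2) by simp
    also have "\<dots> = ?t Q *\<^sub>v (X *\<^sub>v x)"
      by (rule assoc_mult_mat_vec_dim) (use X(1) Q x in simp_all)
    also have "\<dots> = (?t P * Y) *\<^sub>v (X *\<^sub>v x)" using Y(2) by simp
    also have "\<dots> = ?t P *\<^sub>v (Y *\<^sub>v (X *\<^sub>v x))"
      by (rule assoc_mult_mat_vec_dim) (use X(1) Y(1) P x in simp_all)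
    finally have eq: "?t P *\<^sub>v x = ?t P *\<^sub>v (Y *\<^sub>v (X *\<^sub>v x))" .
    have "?t P *\<^sub>v (Y *\<^sub>v (X *\<^sub>v x) - x) = ?t P *\<^sub>v (Y *\<^sub>v (X *\<^sub>v x)) - ?t P *\<^sub>v x"
      by (rule mult_minus_vec_dim) (use carrier_vecD[OF YXx] x P in simp_all)
    also have "\<dots> = 0\<^sub>v b" unfolding eq[symmetric] using P by (intro eq_vecI) auto
    finally have "Y *\<^sub>v (X *\<^sub>v x) - x = 0\<^sub>v r"
      using ind x YXx unfolding rows_indep_def carrier_matD[OF P] by auto
    hence "Y *\<^sub>v (X *\<^sub>v x) = x" by (rule vec_diff_zeroD[OF YXx x])
    thus "(Y * X) *\<^sub>v x = 1\<^sub>m r *\<^sub>v x" using assoc_mult_mat_vec[OF Y(1) X(1) x] x by simp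
  qed (use X(1) Y(1) in auto)
  thus ?thesis by (rule mat_right_inverse_dim_le[OF Y(1) X(1)])
qed

lemma poly_basis_of_dim_row:
  assumes "poly_basis_of b V P" "poly_basis_of b V Q"
  shows "dim_row P = dim_row Q"
proof -
  have P: "rat_mat P \<in> carrier_mat (dim_row P) b" and Q: "rat_mat Q \<in> carrier_mat (dim_row Q) b"
    using assms by (auto simp: poly_basis_of_def intro!: carrier_matI)
  show ?thesis
    using rows_indep_dim_le[OF P Q] rows_indep_dim_le[OF Q P] assms
    unfolding poly_basis_of_def by (intro antisym) blast+
qed

text \<open>The matrices are rectangular and inverse to each other only on the two subspaces. Giving
  the isomorphism by matrices makes its linearity automatic.\<close>

definition inverse_maps :: "'b::semiring_0 mat \<Rightarrow> 'b mat \<Rightarrow> 'b vec set \<Rightarrow> 'b vec set \<Rightarrow> bool" where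
  "inverse_maps F H V W \<longleftrightarrow> (\<forall>x\<in>V. F *\<^sub>v x \<in> W \<and> H *\<^sub>v (F *\<^sub>v x) = x) \<and>
     (\<forall>y\<in>W. H *\<^sub>v y \<in> V \<and> F *\<^sub>v (H *\<^sub>v y) = y)"

lemma inverse_maps_sym: "inverse_maps F H V W \<Longrightarrow> inverse_maps H F W V"
  unfolding inverse_maps_def by blast

lemma poly_basis_of_image:
  assumes F: "F \<in> carrier_mat b a" and H: "H \<in> carrier_mat a b"
    and inv: "inverse_maps F H V W"
    and P: "poly_basis_of a V P" "P \<in> carrier_mat r a" and Q: "Q \<in> carrier_mat r b"
    and rows: "\<And>i. i < r \<Longrightarrow> rat_vec (row Q i) = F *\<^sub>v rat_vec (row P i)"
  shows "poly_basis_of b W Q"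
proof -
  let ?t = transpose_mat
  have Pc: "rat_mat P \<in> carrier_mat r a" and Qc: "rat_mat Q \<in> carrier_mat r b" using P Q by auto
  have ind: "rows_indep (rat_mat P)" and V: "row_space (rat_mat P) = V"
    using P by (auto simp: poly_basis_of_def)
  have tQ: "?t (rat_mat Q) = F * ?t (rat_mat P)"
  proof (rule eq_matI)
    fix j i assume "j < dim_row (F * ?t (rat_mat P))" "i < dim_col (F * ?t (rat_mat P))"
    hence ij: "j < b" "i < r" using F P by auto
    have "row (rat_mat P) i = rat_vec (row P i)" using ij P by (intro eq_vecI) auto
    thus "?t (rat_mat Q) $$ (j, i) = (F * ?t (rat_mat P)) $$ (j, i)"
      using arg_cong[OF rows[OF ij(2)], of "\<lambda>v. v $ j"] ij F P Q by simp
  qed (use F P Q in auto)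
  have Qv: "?t (rat_mat Q) *\<^sub>v c = F *\<^sub>v (?t (rat_mat P) *\<^sub>v c)" if "c \<in> carrier_vec r" for c
    unfolding tQ by (rule assoc_mult_mat_vec_dim) (use F P that in auto)
  have PV: "?t (rat_mat P) *\<^sub>v c \<in> V" if "c \<in> carrier_vec r" for c
    using that Pc unfolding V[symmetric] row_space_def by auto
  have "rows_indep (rat_mat Q)"
    unfolding rows_indep_def carrier_matD[OF Qc]
  proof (intro ballI impI)
    fix c :: "'a poly fract vec" assume c: "c \<in> carrier_vec r" "?t (rat_mat Q) *\<^sub>v c = 0\<^sub>v b"
    have "?t (rat_mat P) *\<^sub>v c = H *\<^sub>v (F *\<^sub>v (?t (rat_mat P) *\<^sub>v c))"
      using inv PV[OF c(1)] unfolding inverse_maps_def by simp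
    also have "\<dots> = 0\<^sub>v a" using c(2) H by (simp add: Qv[OF c(1)] mult_mat_zero_vec)
    finally show "c = 0\<^sub>v r"
      using ind c(1) unfolding rows_indep_def carrier_matD[OF Pc] by blast
  qed
  moreover have "row_space (rat_mat Q) = W"
  proof (intro equalityI subsetI)
    fix x assume "x \<in> row_space (rat_mat Q)"
    then obtain c where c: "c \<in> carrier_vec r" "x = ?t (rat_mat Q) *\<^sub>v c"
      using Qc unfolding row_space_def by auto
    thus "x \<in> W" using inv PV[OF c(1)] Qv[OF c(1)] unfolding inverse_maps_def by simp
  next
    fix x assume x: "x \<in> W"
    hence "H *\<^sub>v x \<in> row_space (rat_mat P)" "F *\<^sub>v (H *\<^sub>v x) = x"
      using inv unfolding V inverse_maps_def by auto
    then obtain c where c: "c \<in> carrier_vec r" "x = ?t (rat_mat Q) *\<^sub>v c"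
      using Pc Qv unfolding row_space_def by auto
    thus "x \<in> row_space (rat_mat Q)" using Qc unfolding row_space_def by auto
  qed
  ultimately show ?thesis using Q by (simp add: poly_basis_of_def)
qed

lemma poly_basis_of_rows:
  assumes "poly_basis_of a V P" and i: "i < dim_row P"
  shows "rat_vec (row P i) \<in> V" "row P i \<noteq> 0\<^sub>v a" "row P i \<in> carrier_vec a"
proof -
  let ?r = "dim_row P"
  have P: "dim_col P = a" using assms by (auto simp: poly_basis_of_def)
  have eq: "rat_vec (row P i) = transpose_mat (rat_mat P) *\<^sub>v unit_vec ?r i"
    using i P by (intro eq_vecI) auto
  have "rat_vec (row P i) \<in> row_space (rat_mat P)" 
    unfolding row_space_def eq by (intro CollectI exI[of _ "unit_vec ?r i"]) simp
  thus "rat_vec (row P i) \<in> V" using assms(1) by (simp add: poly_basis_of_def)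
  show "row P i \<in> carrier_vec a" using P by auto
  show "row P i \<noteq> 0\<^sub>v a"
  proof
    assume "row P i = 0\<^sub>v a"
    hence "transpose_mat (rat_mat P) *\<^sub>v unit_vec ?r i = 0\<^sub>v (dim_col P)"
      unfolding eq[symmetric] using P by (simp add: to_fract_hom.vec_hom_zero)
    moreover have "rows_indep (rat_mat P)" using assms(1) by (simp add: poly_basis_of_def)
    ultimately have "unit_vec ?r i = (0\<^sub>v ?r :: 'a poly fract vec)"
      unfolding rows_indep_def rat_mat_dim by (metis unit_vec_carrier)
    from arg_cong[OF this, of "\<lambda>z. z $ i"] show False using i by simp
  qed
qed

text \<open>\<open>F\<close> carries \<open>P\<close> to a basis whose total degree is larger by
  \<open>d\<close> times the number of rows. Conversely every competitor \<open>Q'\<close> pulls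
  back through \<open>H\<close> to a polynomial basis of \<open>V\<close> whose total degree is
  smaller by the same amount, so minimality transfers.\<close>

lemma minimal_basis_of_shift:
  fixes F H :: "'a::field poly fract mat"
  assumes F: "F \<in> carrier_mat b a" and H: "H \<in> carrier_mat a b"
    and inv: "inverse_maps F H V W"
    and Fpoly: "\<And>u. u \<in> carrier_vec a \<Longrightarrow> rat_vec u \<in> V \<Longrightarrow> u \<noteq> 0\<^sub>v a \<Longrightarrow>
      \<exists>w\<in>carrier_vec b. rat_vec w = F *\<^sub>v rat_vec u \<and> vec_degree w = vec_degree u + d"
    and Hpoly: "\<And>w. w \<in> carrier_vec b \<Longrightarrow> rat_vec w \<in> W \<Longrightarrow>
      \<exists>u\<in>carrier_vec a. rat_vec u = H *\<^sub>v rat_vec w"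
    and min: "minimal_basis_of a V P"
  shows "\<exists>Q. minimal_basis_of b W Q \<and> dim_row Q = dim_row P \<and>
    (\<forall>i<dim_row P. row_degree Q i = row_degree P i + d)"
proof -
  let ?r = "dim_row P"
  have Pb: "poly_basis_of a V P" using min by (simp add: minimal_basis_of_def)
  have P: "P \<in> carrier_mat ?r a" using Pb by (auto simp: poly_basis_of_def)
  have "\<exists>w\<in>carrier_vec b. rat_vec w = F *\<^sub>v rat_vec (row P i) \<and> vec_degree w = vec_degree (row P i) + d"
    if "i < ?r" for i
    using Fpoly poly_basis_of_rows[OF Pb that] by blast
  then obtain w where w: "\<And>i. i < ?r \<Longrightarrow> w i \<in> carrier_vec b"
    "\<And>i. i < ?r \<Longrightarrow> rat_vec (w i) = F *\<^sub>v rat_vec (row P i)"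
    "\<And>i. i < ?r \<Longrightarrow> vec_degree (w i) = vec_degree (row P i) + d" by metis
  define Q where "Q = mat ?r b (\<lambda>(i, j). w i $ j)"
  have Q: "Q \<in> carrier_mat ?r b" by (simp add: Q_def)
  have rowQ: "row Q i = w i" if "i < ?r" for i
    using w(1)[OF that] that by (intro eq_vecI) (auto simp: Q_def)
  have Qb: "poly_basis_of b W Q"
    by (rule poly_basis_of_image[OF F H inv Pb P Q]) (simp add: rowQ w)
  have deg: "row_degree Q i = row_degree P i + d" if "i < ?r" for i
    using that Q by (simp add: row_degree_eq_vec_degree rowQ w)
  hence totQ: "total_degree Q = total_degree P + ?r * d"
    using Q by (simp add: total_degree_def sum.distrib)
  have "total_degree Q \<le> total_degree Q'" if Q'b: "poly_basis_of b W Q'" for Q'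
  proof -
    have rQ': "dim_row Q' = ?r" using poly_basis_of_dim_row[OF Q'b Qb] Q by simp
    have Q': "Q' \<in> carrier_mat ?r b" using Q'b rQ' by (auto simp: poly_basis_of_def)
    have "\<exists>u\<in>carrier_vec a. rat_vec u = H *\<^sub>v rat_vec (row Q' i)" if "i < ?r" for i
      using Hpoly poly_basis_of_rows[OF Q'b] that rQ' by metis
    then obtain u where u: "\<And>i. i < ?r \<Longrightarrow> u i \<in> carrier_vec a"
      "\<And>i. i < ?r \<Longrightarrow> rat_vec (u i) = H *\<^sub>v rat_vec (row Q' i)" by metis
    define P' where "P' = mat ?r a (\<lambda>(i, j). u i $ j)"
    have P': "P' \<in> carrier_mat ?r a" by (simp add: P'_def)
    have rowP': "row P' i = u i" if "i < ?r" for i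
      using u(1)[OF that] that by (intro eq_vecI) (auto simp: P'_def)
    have P'b: "poly_basis_of a V P'"
      by (rule poly_basis_of_image[OF H F inverse_maps_sym[OF inv] Q'b Q' P']) (simp add: rowP' u)
    \<comment> \<open>No degree assumption is made on \<open>H\<close>. As \<open>F\<close> returns
      the pulled back row to the row of \<open>Q'\<close>, the formula for \<open>F\<close> supplies
      the relation.\<close>
    have deg: "row_degree Q' i = row_degree P' i + d" if i: "i < ?r" for i
    proof -
      have i': "i < dim_row P'" "i < dim_row Q'" using i P' Q' by auto
      obtain v where v: "rat_vec v = F *\<^sub>v rat_vec (row P' i)" "vec_degree v = vec_degree (row P' i) + d"
        using Fpoly poly_basis_of_rows[OF P'b i'(1)] by blast
      have "rat_vec v = F *\<^sub>v (H *\<^sub>v rat_vec (row Q' i))" using v(1) i by (simp add: rowP' u)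
      also have "\<dots> = rat_vec (row Q' i)"
        using inv poly_basis_of_rows(1)[OF Q'b i'(2)] unfolding inverse_maps_def by blast
      finally have "v = row Q' i" by (rule rat_vec_inj)
      thus ?thesis using v(2) i' by (simp add: row_degree_eq_vec_degree)
    qed
    hence "total_degree Q' = total_degree P' + ?r * d"
      using P' Q' by (simp add: total_degree_def sum.distrib)
    moreover have "total_degree P \<le> total_degree P'"
      using min P'b unfolding minimal_basis_of_def by blast
    ultimately show ?thesis using totQ by simp
  qed
  with Qb Q deg show ?thesis unfolding minimal_basis_of_def by auto
qed

lemma right_minimal_indices_shift:
  fixes F H :: "'a::field poly fract mat"
  assumes F: "F \<in> carrier_mat (dim_col L) (dim_col G)" and H: "H \<in> carrier_mat (dim_col G) (dim_col L)"
    and inv: "inverse_maps F H (right_null_space G) (right_null_space L)"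
    and Fpoly: "\<And>u. u \<in> carrier_vec (dim_col G) \<Longrightarrow> rat_vec u \<in> right_null_space G \<Longrightarrow> u \<noteq> 0\<^sub>v (dim_col G) \<Longrightarrow>
      \<exists>w\<in>carrier_vec (dim_col L). rat_vec w = F *\<^sub>v rat_vec u \<and> vec_degree w = vec_degree u + d"
    and Hpoly: "\<And>w. w \<in> carrier_vec (dim_col L) \<Longrightarrow> rat_vec w \<in> right_null_space L \<Longrightarrow>
      \<exists>u\<in>carrier_vec (dim_col G). rat_vec u = H *\<^sub>v rat_vec w"
    and E: "right_minimal_indices G E"
  shows "right_minimal_indices L (image_mset (\<lambda>e. e + d) E)"
proof -
  obtain P where P: "minimal_basis_of (dim_col G) (right_null_space G) P"
    and E: "E = mset (map (row_degree P) [0..<dim_row P])"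
    using E unfolding right_minimal_indices_def by auto
  obtain Q where Q: "minimal_basis_of (dim_col L) (right_null_space L) Q" "dim_row Q = dim_row P"
    "\<forall>i<dim_row P. row_degree Q i = row_degree P i + d"
    using minimal_basis_of_shift[OF F H inv Fpoly Hpoly P] by blast
  have "image_mset (\<lambda>e. e + d) E = mset (map (\<lambda>i. row_degree P i + d) [0..<dim_row P])"
    unfolding E by (simp add: image_mset.compositionality comp_def)
  also have "map (\<lambda>i. row_degree P i + d) [0..<dim_row P] = map (row_degree Q) [0..<dim_row Q]"
    using Q by simp
  finally show ?thesis using Q(1) unfolding right_minimal_indices_def by blast
qed

section \<open>Block matrices\<close>

lemma append_cols_carrier [simp]:
  "X \<in> carrier_mat a b \<Longrightarrow> Y \<in> carrier_mat a c \<Longrightarrow> append_cols X Y \<in> carrier_mat a (b + c)"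
  unfolding append_cols_def by (auto intro!: carrier_append_rows)

lemma append_rows_index:
  assumes "X \<in> carrier_mat a c" "Y \<in> carrier_mat b c" "i < a + b" "j < c"
  shows "(X @\<^sub>r Y) $$ (i, j) = (if i < a then X $$ (i, j) else Y $$ (i - a, j))"
  using assms unfolding append_rows_def by auto

lemma append_cols_index:
  assumes "X \<in> carrier_mat a b" "Y \<in> carrier_mat a c" "i < a" "j < b + c"
  shows "append_cols X Y $$ (i, j) = (if j < b then X $$ (i, j) else Y $$ (i, j - b))"
proof -
  have "transpose_mat X @\<^sub>r transpose_mat Y \<in> carrier_mat (b + c) a"
    using assms by (intro carrier_append_rows) auto
  thus ?thesis
    using assms append_rows_index[of "transpose_mat X" b a "transpose_mat Y" c j i]
      carrier_matD[of "transpose_mat X @\<^sub>r transpose_mat Y" "b + c" a]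
    unfolding append_cols_def by auto
qed

lemma append_cols_mult_vec:
  fixes X Y :: "'a::comm_semiring_0 mat"
  assumes X: "X \<in> carrier_mat a b" and Y: "Y \<in> carrier_mat a c"
    and u: "u \<in> carrier_vec b" and v: "v \<in> carrier_vec c"
  shows "append_cols X Y *\<^sub>v (u @\<^sub>v v) = X *\<^sub>v u + Y *\<^sub>v v"
proof (rule eq_vecI)
  have XY: "append_cols X Y \<in> carrier_mat a (b + c)" using X Y by simp
  fix i assume "i < dim_vec (X *\<^sub>v u + Y *\<^sub>v v)"
  hence i: "i < a" using Y by simp
  have "row (append_cols X Y) i = row X i @\<^sub>v row Y i"
    using carrier_matD[OF XY] X Y i by (intro eq_vecI) (auto simp: append_cols_index[OF X Y])
  thus "(append_cols X Y *\<^sub>v (u @\<^sub>v v)) $ i = (X *\<^sub>v u + Y *\<^sub>v v) $ i"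
    using carrier_matD[OF XY] i X Y u v scalar_prod_append[of "row X i" b "row Y i" c u v] by auto
next
  have XY: "append_cols X Y \<in> carrier_mat a (b + c)" using X Y by simp
  show "dim_vec (append_cols X Y *\<^sub>v (u @\<^sub>v v)) = dim_vec (X *\<^sub>v u + Y *\<^sub>v v)"
    using carrier_matD[OF XY] Y by simp
qed

lemma rat_mat_append_rows:
  assumes X: "X \<in> carrier_mat a c" and Y: "Y \<in> carrier_mat b c"
  shows "rat_mat (X @\<^sub>r Y) = rat_mat X @\<^sub>r rat_mat Y"
proof -
  have XY: "X @\<^sub>r Y \<in> carrier_mat (a + b) c" "rat_mat X @\<^sub>r rat_mat Y \<in> carrier_mat (a + b) c"
    using X Y by auto
  show ?thesis
    using carrier_matD[OF XY(1)] carrier_matD[OF XY(2)] X Y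
    by (intro eq_matI) (auto simp: append_rows_index[of _ a c _ b])
qed

lemma rat_mat_append_cols:
  assumes X: "X \<in> carrier_mat a b" and Y: "Y \<in> carrier_mat a c"
  shows "rat_mat (append_cols X Y) = append_cols (rat_mat X) (rat_mat Y)"
  using rat_mat_append_rows[of "transpose_mat X" b a "transpose_mat Y" c] X Y
  unfolding append_cols_def by (simp add: rat_mat_transpose)

lemma zero_mat_mult_vec: "x \<in> carrier_vec b \<Longrightarrow> 0\<^sub>m a b *\<^sub>v x = (0\<^sub>v a :: 'a::semiring_0 vec)"
  by (intro eq_vecI) (auto simp: scalar_prod_def)

lemma append_vec_zero: "0\<^sub>v (a + b) = 0\<^sub>v a @\<^sub>v 0\<^sub>v b"
  by (intro eq_vecI) auto

text \<open>Applying the identity to \<open>u @\<^sub>v v\<close> and comparing both parts, once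
  with \<open>v\<close> zero and once with \<open>u\<close> zero, isolates the four blocks.\<close>

lemma append_rows_mult_append_cols_one:
  fixes K Kh :: "'a::comm_ring_1 mat"
  assumes K: "K \<in> carrier_mat k c" and Kh: "Kh \<in> carrier_mat h c"
    and Nh: "Nh \<in> carrier_mat c k" and N: "N \<in> carrier_mat c h"
    and one: "(K @\<^sub>r Kh) * append_cols Nh N = 1\<^sub>m (k + h)"
  shows "K * Nh = 1\<^sub>m k" "K * N = 0\<^sub>m k h" "Kh * Nh = 0\<^sub>m h k" "Kh * N = 1\<^sub>m h"
proof -
  have KK: "K @\<^sub>r Kh \<in> carrier_mat (k + h) c" and NN: "append_cols Nh N \<in> carrier_mat c (k + h)"
    using K Kh Nh N by auto
  have eq: "(K *\<^sub>v (Nh *\<^sub>v u + N *\<^sub>v v)) = u \<and> (Kh *\<^sub>v (Nh *\<^sub>v u + N *\<^sub>v v)) = v"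
    if u: "u \<in> carrier_vec k" and v: "v \<in> carrier_vec h" for u v
  proof -
    have w: "Nh *\<^sub>v u + N *\<^sub>v v \<in> carrier_vec c" using Nh N u v by auto
    have "u @\<^sub>v v = (K @\<^sub>r Kh) *\<^sub>v (append_cols Nh N *\<^sub>v (u @\<^sub>v v))"
      using assoc_mult_mat_vec[OF KK NN, of "u @\<^sub>v v"] one u v by simp
    also have "\<dots> = (K *\<^sub>v (Nh *\<^sub>v u + N *\<^sub>v v)) @\<^sub>v (Kh *\<^sub>v (Nh *\<^sub>v u + N *\<^sub>v v))"
      using append_cols_mult_vec[OF Nh N u v] mat_mult_append[OF K Kh w] by simp
    finally have "u @\<^sub>v v = (K *\<^sub>v (Nh *\<^sub>v u + N *\<^sub>v v)) @\<^sub>v (Kh *\<^sub>v (Nh *\<^sub>v u + N *\<^sub>v v))" .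
    moreover have "K *\<^sub>v (Nh *\<^sub>v u + N *\<^sub>v v) \<in> carrier_vec k" using K by (auto intro: carrier_vecI)
    ultimately show ?thesis using append_vec_eq[OF u, of _ v] by metis
  qed
  have N0: "Nh *\<^sub>v u + N *\<^sub>v 0\<^sub>v h = Nh *\<^sub>v u" "Nh *\<^sub>v 0\<^sub>v k + N *\<^sub>v v = N *\<^sub>v v" for u v
    using Nh N by (auto simp: vec_eq_iff)
  show "K * Nh = 1\<^sub>m k"
  proof (rule mat_eq_by_vec[of _ k k])
    fix x :: "'a vec" assume x: "x \<in> carrier_vec k"
    show "(K * Nh) *\<^sub>v x = 1\<^sub>m k *\<^sub>v x"
      using eq[OF x, of "0\<^sub>v h"] x unfolding N0 assoc_mult_mat_vec[OF K Nh x] by simp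
  qed (use K Nh in auto)
  show "K * N = 0\<^sub>m k h"
  proof (rule mat_eq_by_vec[of _ k h])
    fix x :: "'a vec" assume x: "x \<in> carrier_vec h"
    show "(K * N) *\<^sub>v x = 0\<^sub>m k h *\<^sub>v x"
      using eq[OF _ x, of "0\<^sub>v k"] x unfolding N0 assoc_mult_mat_vec[OF K N x] by (simp add: zero_mat_mult_vec)
  qed (use K N in auto)
  show "Kh * Nh = 0\<^sub>m h k"
  proof (rule mat_eq_by_vec[of _ h k])
    fix x :: "'a vec" assume x: "x \<in> carrier_vec k"
    show "(Kh * Nh) *\<^sub>v x = 0\<^sub>m h k *\<^sub>v x"
      using eq[OF x, of "0\<^sub>v h"] x unfolding N0 assoc_mult_mat_vec[OF Kh Nh x] by (simp add: zero_mat_mult_vec)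
  qed (use Kh Nh in auto)
  show "Kh * N = 1\<^sub>m h"
  proof (rule mat_eq_by_vec[of _ h h])
    fix x :: "'a vec" assume x: "x \<in> carrier_vec h"
    show "(Kh * N) *\<^sub>v x = 1\<^sub>m h *\<^sub>v x"
      using eq[OF _ x, of "0\<^sub>v k"] x unfolding N0 assoc_mult_mat_vec[OF Kh N x] by simp
  qed (use Kh N in auto)
qed

lemma append_cols_mult_append_rows:
  fixes K Kh :: "'a::comm_ring_1 mat"
  assumes K: "K \<in> carrier_mat k c" and Kh: "Kh \<in> carrier_mat h c"
    and Nh: "Nh \<in> carrier_mat d k" and N: "N \<in> carrier_mat d h"
  shows "append_cols Nh N * (K @\<^sub>r Kh) = Nh * K + N * Kh"
proof (rule mat_eq_by_vec[of _ d c])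
  have KK: "K @\<^sub>r Kh \<in> carrier_mat (k + h) c" and NN: "append_cols Nh N \<in> carrier_mat d (k + h)"
    using K Kh Nh N by auto
  thus "append_cols Nh N * (K @\<^sub>r Kh) \<in> carrier_mat d c" by simp
  show "Nh * K + N * Kh \<in> carrier_mat d c" using K Kh Nh N by auto
  fix x :: "'a vec" assume x: "x \<in> carrier_vec c"
  have "(append_cols Nh N * (K @\<^sub>r Kh)) *\<^sub>v x = append_cols Nh N *\<^sub>v ((K *\<^sub>v x) @\<^sub>v (Kh *\<^sub>v x))"
    using assoc_mult_mat_vec[OF NN KK x] mat_mult_append[OF K Kh x] by simp
  also have "\<dots> = Nh *\<^sub>v (K *\<^sub>v x) + N *\<^sub>v (Kh *\<^sub>v x)"
    by (rule append_cols_mult_vec[OF Nh N]) (use K Kh x in auto)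
  also have "\<dots> = (Nh * K) *\<^sub>v x + (N * Kh) *\<^sub>v x"
    using assoc_mult_mat_vec[OF Nh K x] assoc_mult_mat_vec[OF N Kh x] by simp
  also have "\<dots> = (Nh * K + N * Kh) *\<^sub>v x"
    by (rule add_mult_distrib_mat_vec[symmetric]) (use K Kh Nh N x in auto)
  finally show "(append_cols Nh N * (K @\<^sub>r Kh)) *\<^sub>v x = (Nh * K + N * Kh) *\<^sub>v x" .
qed

text \<open>One order of the product yields the four block relations. The other order yields a
  resolution of the identity, which later splits a vector into a part seen by \<open>K\<close> and a
  part seen by \<open>Kh\<close>.\<close>

lemma unimodular_completion:
  fixes K Kh N Nh :: "'a::comm_ring_1 mat"
  assumes K: "K \<in> carrier_mat k (h + k)" and Kh: "Kh \<in> carrier_mat h (h + k)"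
    and Nh: "Nh \<in> carrier_mat k (h + k)" and N: "N \<in> carrier_mat h (h + k)"
    and one: "(K @\<^sub>r Kh) * append_cols (transpose_mat Nh) (transpose_mat N) = 1\<^sub>m (h + k)"
      "append_cols (transpose_mat Nh) (transpose_mat N) * (K @\<^sub>r Kh) = 1\<^sub>m (h + k)"
  shows "K * transpose_mat Nh = 1\<^sub>m k" "K * transpose_mat N = 0\<^sub>m k h"
    "Kh * transpose_mat Nh = 0\<^sub>m h k" "Kh * transpose_mat N = 1\<^sub>m h"
    "transpose_mat Nh * K + transpose_mat N * Kh = 1\<^sub>m (h + k)"
proof -
  have t: "transpose_mat Nh \<in> carrier_mat (h + k) k" "transpose_mat N \<in> carrier_mat (h + k) h"
    using N Nh by auto
  have one': "(K @\<^sub>r Kh) * append_cols (transpose_mat Nh) (transpose_mat N) = 1\<^sub>m (k + h)"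
    using one(1) by (simp add: add.commute)
  show "K * transpose_mat Nh = 1\<^sub>m k" "K * transpose_mat N = 0\<^sub>m k h"
    "Kh * transpose_mat Nh = 0\<^sub>m h k" "Kh * transpose_mat N = 1\<^sub>m h"
    by (rule append_rows_mult_append_cols_one[OF K Kh t one'])+
  show "transpose_mat Nh * K + transpose_mat N * Kh = 1\<^sub>m (h + k)"
    using append_cols_mult_append_rows[OF K Kh t] one(2) by simp
qed

section \<open>The null space of the linearization\<close>

lemma vec_add_zero_imp_uminus:
  fixes u v :: "'a::ab_group_add vec"
  assumes "u \<in> carrier_vec n" "v \<in> carrier_vec n" "u + v = 0\<^sub>v n"
  shows "u = - v"
proof (rule eq_vecI)
  fix i assume "i < dim_vec (- v)"
  thus "u $ i = (- v) $ i"
    using assms(1,2) arg_cong[OF assms(3), of "\<lambda>z. z $ i"] by (auto simp: eq_neg_iff_add_eq_0)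
qed (use assms in auto)

lemma block_mult_vec:
  fixes X1 :: "'a::comm_semiring_0 mat"
  assumes "X1 \<in> carrier_mat a b1" "Y1 \<in> carrier_mat a b2" "Z1 \<in> carrier_mat a b3"
    "x \<in> carrier_vec b1" "y \<in> carrier_vec b2" "z \<in> carrier_vec b3"
  shows "append_cols (append_cols X1 Y1) Z1 *\<^sub>v ((x @\<^sub>v y) @\<^sub>v z) = X1 *\<^sub>v x + Y1 *\<^sub>v y + Z1 *\<^sub>v z"
  using append_cols_mult_vec[of "append_cols X1 Y1" a "b1 + b2" Z1 b3 "x @\<^sub>v y" z]
    append_cols_mult_vec[of X1 a b1 Y1 b2 x y] assms by simp

lemma all_vec_append3:
  "(\<forall>w\<in>carrier_vec (a + b + c). P w) \<longleftrightarrow>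
   (\<forall>x\<in>carrier_vec a. \<forall>y\<in>carrier_vec b. \<forall>z\<in>carrier_vec c. P ((x @\<^sub>v y) @\<^sub>v z))"
  unfolding all_vec_append by blast

text \<open>In this locale \<open>P\<close> stands for \<open>\<lambda>I - A\<close>, lower-case letters for the rational images of the
  polynomial matrices, and \<open>n1\<close>, \<open>n1h\<close>, \<open>k2\<close>, \<open>k2h\<close> for those of their transposes.\<close>

locale sbmb_blocks =
  fixes P R T Ti S Si B C M k1 k1h n1 n1h k2 k2h n2 n2h G :: "'a::idom fract mat"
    and n p m ph mh :: nat
  assumes P: "P \<in> carrier_mat n n" and R: "R \<in> carrier_mat n n"
    and T: "T \<in> carrier_mat n n" and Ti: "Ti \<in> carrier_mat n n"
    and S: "S \<in> carrier_mat n n" and Si: "Si \<in> carrier_mat n n"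
    and B: "B \<in> carrier_mat n m" and C: "C \<in> carrier_mat p n"
    and M: "M \<in> carrier_mat (p + ph) (m + mh)"
    and k1: "k1 \<in> carrier_mat mh (m + mh)" and k1h: "k1h \<in> carrier_mat m (m + mh)"
    and n1: "n1 \<in> carrier_mat (m + mh) m" and n1h: "n1h \<in> carrier_mat (m + mh) mh"
    and k2: "k2 \<in> carrier_mat (p + ph) ph" and k2h: "k2h \<in> carrier_mat (p + ph) p"
    and n2: "n2 \<in> carrier_mat p (p + ph)" and n2h: "n2h \<in> carrier_mat ph (p + ph)"
    and RP: "R * P = 1\<^sub>m n" and PR: "P * R = 1\<^sub>m n"
    and TiT: "Ti * T = 1\<^sub>m n" and SiS: "Si * S = 1\<^sub>m n" and SSi: "S * Si = 1\<^sub>m n"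
    and k1n1: "k1 * n1 = 0\<^sub>m mh m" and k1hn1: "k1h * n1 = 1\<^sub>m m"
    and split1: "n1h * k1 + n1 * k1h = 1\<^sub>m (m + mh)"
    and n2k2: "n2 * k2 = 0\<^sub>m p ph" and n2k2h: "n2 * k2h = 1\<^sub>m p"
    and n2hk2: "n2h * k2 = 1\<^sub>m ph" and n2hk2h: "n2h * k2h = 0\<^sub>m ph p"
    and split2: "k2 * n2h + k2h * n2 = 1\<^sub>m (p + ph)"
    and G: "G = n2 * M * n1 + C * R * B"
begin

definition "Lin = append_cols (append_cols (T * P * S) (T * B * k1h)) (0\<^sub>m n ph)
  @\<^sub>r append_cols (append_cols (- (k2h * C * S)) M) k2
  @\<^sub>r append_cols (append_cols (0\<^sub>m mh n) k1) (0\<^sub>m mh ph)"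

definition "Emb = (- (Si * R * B) @\<^sub>r n1) @\<^sub>r - (n2h * M * n1)"

definition "Proj = append_cols (append_cols (0\<^sub>m m n) k1h) (0\<^sub>m m ph)"

lemma Lin_carrier: "Lin \<in> carrier_mat (n + (p + ph + mh)) (n + (m + mh) + ph)"
  unfolding Lin_def using T P S B k1h k2h C M k2 k1
  by (intro carrier_append_rows append_cols_carrier) auto

lemma Emb_carrier: "Emb \<in> carrier_mat (n + (m + mh) + ph) m"
  unfolding Emb_def using Si R B n1 n2h M by (intro carrier_append_rows) auto

lemma Proj_carrier: "Proj \<in> carrier_mat m (n + (m + mh) + ph)"
  unfolding Proj_def using k1h by (intro append_cols_carrier) auto

lemma G_carrier: "G \<in> carrier_mat p m"
  unfolding G using n2 M n1 C R B by auto

lemma Proj_mult: 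
  assumes "x \<in> carrier_vec n" "y \<in> carrier_vec (m + mh)" "z \<in> carrier_vec ph"
  shows "Proj *\<^sub>v ((x @\<^sub>v y) @\<^sub>v z) = k1h *\<^sub>v y"
  unfolding Proj_def using assms k1h
  by (simp add: block_mult_vec[of _ m n _ "m + mh" _ ph] zero_mat_mult_vec)

lemma Emb_mult:
  assumes u: "u \<in> carrier_vec m"
  shows "Emb *\<^sub>v u = (- (Si *\<^sub>v (R *\<^sub>v (B *\<^sub>v u))) @\<^sub>v n1 *\<^sub>v u) @\<^sub>v - (n2h *\<^sub>v (M *\<^sub>v (n1 *\<^sub>v u)))"
proof -
  have X: "- (Si * R * B) \<in> carrier_mat n m" and Z: "- (n2h * M * n1) \<in> carrier_mat ph m"
    using Si R B n2h M n1 by auto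
  have "- (Si * R * B) *\<^sub>v u = - (Si *\<^sub>v (R *\<^sub>v (B *\<^sub>v u)))"
    using Si R B u by (simp add: assoc_mult_mat_vec_dim)
  moreover have "- (n2h * M * n1) *\<^sub>v u = - (n2h *\<^sub>v (M *\<^sub>v (n1 *\<^sub>v u)))"
    using n2h M n1 u by (simp add: assoc_mult_mat_vec_dim)
  ultimately show ?thesis
    unfolding Emb_def using mat_mult_append[OF carrier_append_rows[OF X n1] Z u] mat_mult_append[OF X n1 u]
    by simp
qed

text \<open>The factor \<open>T\<close> is stripped from the first block row by its inverse, whereas
  \<open>S\<close> belongs to the unknown, which enters only as \<open>S x\<close>.\<close>

lemma Lin_null:
  assumes x: "x \<in> carrier_vec n" and y: "y \<in> carrier_vec (m + mh)" and z: "z \<in> carrier_vec ph"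
  shows "(x @\<^sub>v y) @\<^sub>v z \<in> right_null_space Lin \<longleftrightarrow>
    P *\<^sub>v (S *\<^sub>v x) + B *\<^sub>v (k1h *\<^sub>v y) = 0\<^sub>v n \<and>
    - (k2h *\<^sub>v (C *\<^sub>v (S *\<^sub>v x))) + M *\<^sub>v y + k2 *\<^sub>v z = 0\<^sub>v (p + ph) \<and>
    k1 *\<^sub>v y = 0\<^sub>v mh"
proof -
  let ?w = "(x @\<^sub>v y) @\<^sub>v z"
  have w: "?w \<in> carrier_vec (n + (m + mh) + ph)" using x y z by auto
  let ?L1 = "append_cols (append_cols (T * P * S) (T * B * k1h)) (0\<^sub>m n ph)"
  let ?L2 = "append_cols (append_cols (- (k2h * C * S)) M) k2"
  let ?L3 = "append_cols (append_cols (0\<^sub>m mh n) k1) (0\<^sub>m mh ph)"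
  have L: "?L1 \<in> carrier_mat n (n + (m + mh) + ph)" "?L2 \<in> carrier_mat (p + ph) (n + (m + mh) + ph)"
    "?L3 \<in> carrier_mat mh (n + (m + mh) + ph)"
    using T P S B k1h k2h C M k2 k1 by (intro append_cols_carrier; auto)+
  let ?e1 = "P *\<^sub>v (S *\<^sub>v x) + B *\<^sub>v (k1h *\<^sub>v y)"
  have e1c: "?e1 \<in> carrier_vec n" using B by (auto intro!: carrier_vecI)
  have "?L1 *\<^sub>v ?w = (T * P * S) *\<^sub>v x + (T * B * k1h) *\<^sub>v y + 0\<^sub>m n ph *\<^sub>v z"
    by (rule block_mult_vec) (use T P S B k1h x y z in auto)
  also have "\<dots> = T *\<^sub>v ?e1"
    using T P S B k1h x y z
    by (simp add: assoc_mult_mat_vec_dim mult_add_vec_dim zero_mat_mult_vec vec_eq_iff)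
  finally have 1: "?L1 *\<^sub>v ?w = T *\<^sub>v ?e1" .
  have T0: "T *\<^sub>v ?e1 = 0\<^sub>v n \<longleftrightarrow> ?e1 = 0\<^sub>v n"
  proof
    assume "T *\<^sub>v ?e1 = 0\<^sub>v n"
    hence "Ti *\<^sub>v (T *\<^sub>v ?e1) = 0\<^sub>v n" using Ti by (simp add: mult_mat_zero_vec)
    thus "?e1 = 0\<^sub>v n" using assoc_mult_mat_vec[OF Ti T e1c] TiT e1c by simp
  qed (use T in \<open>simp add: mult_mat_zero_vec\<close>)
  have "?L2 *\<^sub>v ?w = (- (k2h * C * S)) *\<^sub>v x + M *\<^sub>v y + k2 *\<^sub>v z"
    by (rule block_mult_vec) (use k2h C S M k2 x y z in auto)
  also have "(- (k2h * C * S)) *\<^sub>v x = - (k2h *\<^sub>v (C *\<^sub>v (S *\<^sub>v x)))"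
    using k2h C S x by (simp add: assoc_mult_mat_vec_dim)
  finally have 2: "?L2 *\<^sub>v ?w = - (k2h *\<^sub>v (C *\<^sub>v (S *\<^sub>v x))) + M *\<^sub>v y + k2 *\<^sub>v z" .
  have "?L3 *\<^sub>v ?w = 0\<^sub>m mh n *\<^sub>v x + k1 *\<^sub>v y + 0\<^sub>m mh ph *\<^sub>v z"
    by (rule block_mult_vec) (use k1 x y z in auto)
  also have "\<dots> = k1 *\<^sub>v y" using k1 x y z by (simp add: zero_mat_mult_vec)
  finally have 3: "?L3 *\<^sub>v ?w = k1 *\<^sub>v y" .
  have Lw: "Lin *\<^sub>v ?w = ?L1 *\<^sub>v ?w @\<^sub>v (?L2 *\<^sub>v ?w @\<^sub>v ?L3 *\<^sub>v ?w)"
    unfolding Lin_def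
    using mat_mult_append[OF L(1) carrier_append_rows[OF L(2,3)] w] mat_mult_append[OF L(2,3) w] by simp
  have L1w: "?L1 *\<^sub>v ?w \<in> carrier_vec n" and L2w: "?L2 *\<^sub>v ?w \<in> carrier_vec (p + ph)"
    using carrier_matD[OF L(1)] carrier_matD[OF L(2)] by (auto intro!: carrier_vecI)
  have "Lin *\<^sub>v ?w = 0\<^sub>v (n + (p + ph + mh)) \<longleftrightarrow>
      ?L1 *\<^sub>v ?w = 0\<^sub>v n \<and> ?L2 *\<^sub>v ?w = 0\<^sub>v (p + ph) \<and> ?L3 *\<^sub>v ?w = 0\<^sub>v mh"
    unfolding Lw append_vec_zero[of n "p + ph + mh"] append_vec_zero[of "p + ph" mh]
      append_vec_eq[OF L1w zero_carrier_vec] append_vec_eq[OF L2w zero_carrier_vec] ..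
  thus ?thesis
    unfolding right_null_space_def carrier_matD[OF Lin_carrier] mem_Collect_eq 1 2 3 T0 using w by blast
qed

lemma G_mult:
  assumes "u \<in> carrier_vec m"
  shows "G *\<^sub>v u = n2 *\<^sub>v (M *\<^sub>v (n1 *\<^sub>v u)) + C *\<^sub>v (R *\<^sub>v (B *\<^sub>v u))"
proof -
  have "G *\<^sub>v u = (n2 * M * n1) *\<^sub>v u + (C * R * B) *\<^sub>v u"
    unfolding G by (rule add_mult_distrib_mat_vec) (use assms n2 M n1 C R B in auto)
  thus ?thesis using assms n2 M n1 C R B by (simp add: assoc_mult_mat_vec_dim)
qed

lemma cancel:
  shows "u \<in> carrier_vec m \<Longrightarrow> k1h *\<^sub>v (n1 *\<^sub>v u) = u"
    and "u \<in> carrier_vec m \<Longrightarrow> k1 *\<^sub>v (n1 *\<^sub>v u) = 0\<^sub>v mh"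
    and "x \<in> carrier_vec n \<Longrightarrow> P *\<^sub>v (R *\<^sub>v x) = x"
    and "x \<in> carrier_vec n \<Longrightarrow> R *\<^sub>v (P *\<^sub>v x) = x"
    and "x \<in> carrier_vec n \<Longrightarrow> S *\<^sub>v (Si *\<^sub>v x) = x"
    and "x \<in> carrier_vec n \<Longrightarrow> Si *\<^sub>v (S *\<^sub>v x) = x"
    and "v \<in> carrier_vec p \<Longrightarrow> n2 *\<^sub>v (k2h *\<^sub>v v) = v"
    and "v \<in> carrier_vec p \<Longrightarrow> n2h *\<^sub>v (k2h *\<^sub>v v) = 0\<^sub>v ph"
    and "z \<in> carrier_vec ph \<Longrightarrow> n2 *\<^sub>v (k2 *\<^sub>v z) = 0\<^sub>v p"
    and "z \<in> carrier_vec ph \<Longrightarrow> n2h *\<^sub>v (k2 *\<^sub>v z) = z"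
  using assoc_mult_mat_vec[OF k1h n1, of u] assoc_mult_mat_vec[OF k1 n1, of u]
    assoc_mult_mat_vec[OF P R, of x] assoc_mult_mat_vec[OF R P, of x]
    assoc_mult_mat_vec[OF S Si, of x] assoc_mult_mat_vec[OF Si S, of x]
    assoc_mult_mat_vec[OF n2 k2h, of v] assoc_mult_mat_vec[OF n2h k2h, of v]
    assoc_mult_mat_vec[OF n2 k2, of z] assoc_mult_mat_vec[OF n2h k2, of z]
    RP PR SiS SSi k1n1 k1hn1 n2k2 n2k2h n2hk2 n2hk2h
  by (simp_all add: zero_mat_mult_vec)

text \<open>The summand \<open>n1h * k1\<close> of the resolution of the identity dies on the kernel
  of \<open>k1\<close>, so this kernel consists of the vectors \<open>n1 u\<close> with
  \<open>u = k1h y\<close>.\<close>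

lemma split1_vec:
  assumes "y \<in> carrier_vec (m + mh)" "k1 *\<^sub>v y = 0\<^sub>v mh"
  shows "n1 *\<^sub>v (k1h *\<^sub>v y) = y"
proof -
  have "y = (n1h * k1 + n1 * k1h) *\<^sub>v y" using assms split1 by simp
  also have "\<dots> = (n1h * k1) *\<^sub>v y + (n1 * k1h) *\<^sub>v y"
    by (rule add_mult_distrib_mat_vec) (use assms n1h k1 n1 k1h in auto)
  also have "\<dots> = n1h *\<^sub>v 0\<^sub>v mh + n1 *\<^sub>v (k1h *\<^sub>v y)"
    using assms n1h k1 n1 k1h by (simp add: assoc_mult_mat_vec_dim)
  also have "\<dots> = n1 *\<^sub>v (k1h *\<^sub>v y)"
    using n1h n1 by (intro eq_vecI) (auto simp: mult_mat_zero_vec)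
  finally show ?thesis by simp
qed

lemma split2_vec:
  assumes "v \<in> carrier_vec (p + ph)"
  shows "v = k2 *\<^sub>v (n2h *\<^sub>v v) + k2h *\<^sub>v (n2 *\<^sub>v v)"
proof -
  have "v = (k2 * n2h + k2h * n2) *\<^sub>v v" using assms split2 by simp
  also have "\<dots> = (k2 * n2h) *\<^sub>v v + (k2h * n2) *\<^sub>v v"
    by (rule add_mult_distrib_mat_vec) (use assms k2 n2h k2h n2 in auto)
  finally show ?thesis using assms k2 n2h k2h n2 by (simp add: assoc_mult_mat_vec_dim)
qed

text \<open>The second block row is the delicate one. Split \<open>M y\<close> into its
  \<open>k2\<close> and \<open>k2h\<close> components: the choice of \<open>z\<close> cancels the
  first, and \<open>G u = 0\<close> turns the second into the negative of
  \<open>k2h C R B u\<close>, which the state block supplies.\<close>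

lemma Emb_null:
  assumes "u \<in> right_null_space G"
  shows "Emb *\<^sub>v u \<in> right_null_space Lin"
proof -
  have u: "u \<in> carrier_vec m" and Gu: "G *\<^sub>v u = 0\<^sub>v p"
    using assms G_carrier unfolding right_null_space_def by auto
  define x where "x = - (Si *\<^sub>v (R *\<^sub>v (B *\<^sub>v u)))"
  define y where "y = n1 *\<^sub>v u"
  define z where "z = - (n2h *\<^sub>v (M *\<^sub>v y))"
  have Bu: "B *\<^sub>v u \<in> carrier_vec n" "R *\<^sub>v (B *\<^sub>v u) \<in> carrier_vec n" using B R by (auto intro!: carrier_vecI)
  have x: "x \<in> carrier_vec n" and y: "y \<in> carrier_vec (m + mh)" and z: "z \<in> carrier_vec ph"
    using Si n1 n2h by (auto simp: x_def y_def z_def intro!: carrier_vecI)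
  have Sx: "S *\<^sub>v x = - (R *\<^sub>v (B *\<^sub>v u))"
    unfolding x_def using S Si cancel(5)[OF Bu(2)] by (simp add: mult_uminus_vec_dim)
  have "P *\<^sub>v (S *\<^sub>v x) = - (B *\<^sub>v u)"
    unfolding Sx using P R cancel(3)[OF Bu(1)] by (simp add: mult_uminus_vec_dim)
  hence 1: "P *\<^sub>v (S *\<^sub>v x) + B *\<^sub>v (k1h *\<^sub>v y) = 0\<^sub>v n"
    unfolding y_def cancel(1)[OF u] using Bu by simp
  have My: "M *\<^sub>v y \<in> carrier_vec (p + ph)" using M by (auto intro!: carrier_vecI)
  let ?c = "C *\<^sub>v (R *\<^sub>v (B *\<^sub>v u))"
  have c: "?c \<in> carrier_vec p" using C by (auto intro!: carrier_vecI)
  have n2c: "n2 *\<^sub>v (M *\<^sub>v y) = - ?c"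
    using Gu unfolding G_mult[OF u] y_def
    by (intro vec_add_zero_imp_uminus[of _ p]) (use c n2 in \<open>auto intro!: carrier_vecI\<close>)
  have "M *\<^sub>v y = k2 *\<^sub>v (n2h *\<^sub>v (M *\<^sub>v y)) + k2h *\<^sub>v (n2 *\<^sub>v (M *\<^sub>v y))" by (rule split2_vec[OF My])
  also have "k2h *\<^sub>v (n2 *\<^sub>v (M *\<^sub>v y)) = - (k2h *\<^sub>v ?c)"
    unfolding n2c using k2h C by (simp add: mult_uminus_vec_dim)
  also have "k2 *\<^sub>v (n2h *\<^sub>v (M *\<^sub>v y)) = - (k2 *\<^sub>v z)"
    unfolding z_def using k2 n2h by (simp add: mult_uminus_vec_dim)
  finally have My': "M *\<^sub>v y = - (k2 *\<^sub>v z) + - (k2h *\<^sub>v ?c)" .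
  have "k2h *\<^sub>v (C *\<^sub>v (S *\<^sub>v x)) = - (k2h *\<^sub>v ?c)"
    unfolding Sx using C R k2h by (simp add: mult_uminus_vec_dim)
  hence 2: "- (k2h *\<^sub>v (C *\<^sub>v (S *\<^sub>v x))) + M *\<^sub>v y + k2 *\<^sub>v z = 0\<^sub>v (p + ph)"
    unfolding My' using k2 k2h by (intro eq_vecI) auto
  have 3: "k1 *\<^sub>v y = 0\<^sub>v mh" unfolding y_def by (rule cancel(2)[OF u])
  show ?thesis
    unfolding Emb_mult[OF u] using Lin_null[OF x y z] 1 2 3 unfolding x_def[symmetric] y_def[symmetric] z_def[symmetric] by blast
qed

lemma Proj_Emb:
  assumes u: "u \<in> carrier_vec m"
  shows "Proj *\<^sub>v (Emb *\<^sub>v u) = u"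
proof -
  have "Proj *\<^sub>v (Emb *\<^sub>v u) = k1h *\<^sub>v (n1 *\<^sub>v u)"
    unfolding Emb_mult[OF u] by (rule Proj_mult) (use Si n1 n2h in \<open>auto intro!: carrier_vecI\<close>)
  thus ?thesis using cancel(1)[OF u] by simp
qed

text \<open>The third block row gives \<open>y = n1 u\<close>, and the first then gives
  \<open>S x = - R B u\<close>. The second is tested with two left multipliers: \<open>n2\<close>
  eliminates \<open>z\<close> and leaves \<open>G u = 0\<close>, while \<open>n2h\<close> eliminates
  the state term and solves for \<open>z\<close>.\<close>

lemma Lin_null_decomp:
  assumes x: "x \<in> carrier_vec n" and y: "y \<in> carrier_vec (m + mh)" and z: "z \<in> carrier_vec ph"
    and null: "(x @\<^sub>v y) @\<^sub>v z \<in> right_null_space Lin"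
  shows "Proj *\<^sub>v ((x @\<^sub>v y) @\<^sub>v z) \<in> right_null_space G"
    and "Emb *\<^sub>v (Proj *\<^sub>v ((x @\<^sub>v y) @\<^sub>v z)) = (x @\<^sub>v y) @\<^sub>v z"
proof -
  define u where "u = k1h *\<^sub>v y"
  have u: "u \<in> carrier_vec m" using k1h by (auto simp: u_def intro!: carrier_vecI)
  note e = null[unfolded Lin_null[OF x y z], folded u_def]
  have y_eq: "n1 *\<^sub>v u = y" unfolding u_def using split1_vec[OF y] e by blast
  have Bu: "B *\<^sub>v u \<in> carrier_vec n" using B by (auto intro!: carrier_vecI)
  have Sx: "S *\<^sub>v x \<in> carrier_vec n" using S by (auto intro!: carrier_vecI)
  have "P *\<^sub>v (S *\<^sub>v x) = - (B *\<^sub>v u)"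
    by (rule vec_add_zero_imp_uminus[of _ n]) (use e P Bu in \<open>auto intro!: carrier_vecI\<close>)
  hence "R *\<^sub>v (P *\<^sub>v (S *\<^sub>v x)) = - (R *\<^sub>v (B *\<^sub>v u))" using R B by (simp add: mult_uminus_vec_dim)
  hence Sx': "S *\<^sub>v x = - (R *\<^sub>v (B *\<^sub>v u))" using cancel(4)[OF Sx] by simp
  hence "Si *\<^sub>v (S *\<^sub>v x) = - (Si *\<^sub>v (R *\<^sub>v (B *\<^sub>v u)))" using Si R by (simp add: mult_uminus_vec_dim)
  hence x_eq: "- (Si *\<^sub>v (R *\<^sub>v (B *\<^sub>v u))) = x" using cancel(6)[OF x] by simp
  let ?c = "C *\<^sub>v (R *\<^sub>v (B *\<^sub>v u))"
  have c: "?c \<in> carrier_vec p" using C by (auto intro!: carrier_vecI)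
  have "- (k2h *\<^sub>v (C *\<^sub>v (S *\<^sub>v x))) = k2h *\<^sub>v ?c"
    unfolding Sx' using C R k2h by (simp add: mult_uminus_vec_dim)
  hence e2: "k2h *\<^sub>v ?c + M *\<^sub>v y + k2 *\<^sub>v z = 0\<^sub>v (p + ph)" using e by simp
  have "n2 *\<^sub>v (k2h *\<^sub>v ?c + M *\<^sub>v y + k2 *\<^sub>v z) = ?c + n2 *\<^sub>v (M *\<^sub>v y) + 0\<^sub>v p"
    using n2 k2h M k2 cancel(7)[OF c] cancel(9)[OF z] by (simp add: mult_add_vec_dim)
  also have "\<dots> = G *\<^sub>v u"
    unfolding G_mult[OF u] y_eq using n2 C by (intro eq_vecI) (auto simp: add.commute)
  finally have "G *\<^sub>v u = 0\<^sub>v p" unfolding e2 using n2 by (simp add: mult_mat_zero_vec)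
  thus "Proj *\<^sub>v ((x @\<^sub>v y) @\<^sub>v z) \<in> right_null_space G"
    unfolding Proj_mult[OF x y z] u_def[symmetric] right_null_space_def using u G_carrier by simp
  have n2hM: "n2h *\<^sub>v (M *\<^sub>v y) \<in> carrier_vec ph" using n2h by (auto intro!: carrier_vecI)
  have "n2h *\<^sub>v (k2h *\<^sub>v ?c + M *\<^sub>v y + k2 *\<^sub>v z) = 0\<^sub>v ph + n2h *\<^sub>v (M *\<^sub>v y) + z"
    using n2h k2h M k2 cancel(8)[OF c] cancel(10)[OF z] by (simp add: mult_add_vec_dim)
  also have "\<dots> = z + n2h *\<^sub>v (M *\<^sub>v y)" using n2h z by (intro eq_vecI) (auto simp: add.commute)
  finally have "z + n2h *\<^sub>v (M *\<^sub>v y) = 0\<^sub>v ph" unfolding e2 using n2h by (simp add: mult_mat_zero_vec)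
  hence z_eq: "z = - (n2h *\<^sub>v (M *\<^sub>v y))" by (rule vec_add_zero_imp_uminus[OF z n2hM])
  show "Emb *\<^sub>v (Proj *\<^sub>v ((x @\<^sub>v y) @\<^sub>v z)) = (x @\<^sub>v y) @\<^sub>v z"
    unfolding Proj_mult[OF x y z] u_def[symmetric] Emb_mult[OF u] y_eq x_eq using z_eq by simp
qed

lemma inverse_maps_Emb_Proj: "inverse_maps Emb Proj (right_null_space G) (right_null_space Lin)"
proof -
  have "right_null_space G \<subseteq> carrier_vec m" using G_carrier unfolding right_null_space_def by auto
  hence 1: "Emb *\<^sub>v u \<in> right_null_space Lin \<and> Proj *\<^sub>v (Emb *\<^sub>v u) = u" if "u \<in> right_null_space G" for u
    using Emb_null[OF that] Proj_Emb that by blast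
  have "\<forall>w\<in>carrier_vec (n + (m + mh) + ph). w \<in> right_null_space Lin \<longrightarrow>
      Proj *\<^sub>v w \<in> right_null_space G \<and> Emb *\<^sub>v (Proj *\<^sub>v w) = w"
    unfolding all_vec_append3 using Lin_null_decomp by blast
  moreover have "right_null_space Lin \<subseteq> carrier_vec (n + (m + mh) + ph)"
    using carrier_matD[OF Lin_carrier] unfolding right_null_space_def by auto
  ultimately show ?thesis using 1 unfolding inverse_maps_def by blast
qed

end

section \<open>Minimal indices of the linearization\<close>

lemma rat_vec_append: "rat_vec (u @\<^sub>v v) = rat_vec u @\<^sub>v rat_vec v"
  by (intro eq_vecI) auto

lemma rat_vec_uminus: "rat_vec (- u) = - rat_vec u"
  by (intro eq_vecI) auto

lemma vec_degree_const_mat_mult_le: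
  "X \<in> carrier_mat a b \<Longrightarrow> u \<in> carrier_vec b \<Longrightarrow> vec_degree (const_mat X *\<^sub>v u) \<le> vec_degree u"
  using vec_degree_mult_le[of "const_mat X" u 0 "vec_degree u"] by simp

text \<open>The term \<lambda>q has degree one more than \<open>q\<close>, and \<open>A q\<close>
  cannot cancel its top coefficient. For nonzero \<open>q\<close> the bound is even strict.\<close>

lemma vec_degree_state_le:
  assumes A: "A \<in> carrier_mat n n" and q: "q \<in> carrier_vec n" and f: "f \<in> carrier_vec n"
    and eq: "char_pencil A *\<^sub>v q = f"
  shows "vec_degree q \<le> vec_degree f"
proof (cases "q = 0\<^sub>v n")
  case False
  let ?e = "vec_degree q"
  obtain i where i: "i < n" "coeff (q $ i) ?e \<noteq> 0"
    using coeff_vec_degree_nonzero[OF q False] q by (auto simp: vec_eq_iff)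
  have "f $ i = [:0, 1:] * q $ i - (const_mat A *\<^sub>v q) $ i"
    unfolding eq[symmetric] char_pencil_mult_vec[OF A q] using i A q by simp
  moreover have "degree ((const_mat A *\<^sub>v q) $ i) < Suc ?e"
    using degree_le_vec_degree[of i "const_mat A *\<^sub>v q"] vec_degree_const_mat_mult_le[OF A q] i A by simp
  ultimately have "coeff (f $ i) (Suc ?e) = coeff (q $ i) ?e"
    by (simp add: coeff_eq_0)
  hence "Suc ?e \<le> degree (f $ i)" using i by (intro le_degree) simp
  thus ?thesis using degree_le_vec_degree[of i f] i f by simp
qed simp

text \<open>The hypotheses on the two sides are kept apart: degree information is asked of
  \<open>N1\<close> on side 1, of \<open>K2\<close> and \<open>K2h\<close> on side 2, and of
  \<open>M\<close>. Exchanging the sides and transposing thus yields an instance for left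
  indices.\<close>

lemma sbmb_lin_right_minimal_indices:
  fixes G :: "'a::field poly fract mat"
    and D M K1 K2 N1 N2 K1h K2h N1h N2h :: "'a poly mat"
    and A B C T S :: "'a mat"
  assumes G: "G \<in> carrier_mat p m"
    and A: "A \<in> carrier_mat n n" and B: "B \<in> carrier_mat n m" and C: "C \<in> carrier_mat p n"
    and real: "minimal_realization A B C (G - rat_mat D)"
    and K1: "K1 \<in> carrier_mat mh (m + mh)" and K2: "K2 \<in> carrier_mat ph (p + ph)"
    and N1: "N1 \<in> carrier_mat m (m + mh)" and N2: "N2 \<in> carrier_mat p (p + ph)"
    and N1_min: "is_minimal_basis N1" and K2_min: "is_minimal_basis K2" and m: "m > 0"
    and K2_deg: "\<forall>i<ph. row_degree K2 i = 1"
    and N1_deg: "\<forall>i<m. \<forall>j<m. row_degree N1 i = row_degree N1 j"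
    and M: "M \<in> carrier_mat (p + ph) (m + mh)" and M_pencil: "mat_degree M \<le> 1"
    and DM: "D = N2 * M * transpose_mat N1"
    and K1h: "K1h \<in> carrier_mat m (m + mh)"
    and K2h: "K2h \<in> carrier_mat p (p + ph)" and K2h_const: "is_constant_mat K2h"
    and N1h: "N1h \<in> carrier_mat mh (m + mh)" and N2h: "N2h \<in> carrier_mat ph (p + ph)"
    and unimod1: "(K1 @\<^sub>r K1h) * append_cols (transpose_mat N1h) (transpose_mat N1) = 1\<^sub>m (m + mh)"
      "append_cols (transpose_mat N1h) (transpose_mat N1) * (K1 @\<^sub>r K1h) = 1\<^sub>m (m + mh)"
    and unimod2: "(K2 @\<^sub>r K2h) * append_cols (transpose_mat N2h) (transpose_mat N2) = 1\<^sub>m (p + ph)"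
      "append_cols (transpose_mat N2h) (transpose_mat N2) * (K2 @\<^sub>r K2h) = 1\<^sub>m (p + ph)"
    and T: "T \<in> carrier_mat n n" "det T \<noteq> 0"
    and S: "S \<in> carrier_mat n n" "det S \<noteq> 0"
    and E: "right_minimal_indices G E"
  shows "right_minimal_indices (rat_mat (sbmb_lin T S A B C M K1 K2 K1h K2h))
    (image_mset (\<lambda>e. e + mat_degree N1) E)"
proof -
  let ?t = transpose_mat
  let ?c = "\<lambda>X. rat_mat (const_mat X)"
  note u1 = unimodular_completion[OF K1 K1h N1h N1 unimod1]
  note u2 = unimodular_completion[OF K2 K2h N2h N2 unimod2]
  \<comment> \<open>Side 2 enters the linearization transposed, so its relations are needed in
    transposed form.\<close>
  have u2t: "N2h * ?t K2 = 1\<^sub>m ph" "N2 * ?t K2 = 0\<^sub>m p ph" "N2h * ?t K2h = 0\<^sub>m ph p"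
    "N2 * ?t K2h = 1\<^sub>m p" "?t K2 * N2h + ?t K2h * N2 = 1\<^sub>m (p + ph)"
    using arg_cong[OF u2(1), of ?t] arg_cong[OF u2(2), of ?t] arg_cong[OF u2(3), of ?t]
      arg_cong[OF u2(4), of ?t] arg_cong[OF u2(5), of ?t]
      transpose_add[of "?t N2h * K2" "p + ph" "p + ph" "?t N2 * K2h"] K2 K2h N2h N2
    by (simp_all add: transpose_mult_dim)
  have obs: "observable A C" by (rule minimal_realization_observable[OF real A C])
  obtain R where R: "R \<in> carrier_mat n n" "R * rat_mat (char_pencil A) = 1\<^sub>m n"
      "rat_mat (char_pencil A) * R = 1\<^sub>m n" and H: "G - rat_mat D = ?c C * R * ?c B"
  proof -
    from real obtain n' R where A': "A \<in> carrier_mat n' n'" and R: "R \<in> carrier_mat n' n'"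
      "R * rat_mat (char_pencil A) = 1\<^sub>m n'" "rat_mat (char_pencil A) * R = 1\<^sub>m n'"
      "G - rat_mat D = ?c C * R * ?c B"
      unfolding minimal_realization_def realizes_def by blast
    have "n' = n" using carrier_matD(1)[OF A'] carrier_matD(1)[OF A] by simp
    show thesis by (rule that[OF R[unfolded \<open>n' = n\<close>]])
  qed
  have D: "D \<in> carrier_mat p m" unfolding DM using N1 N2 M by auto
  have ratD: "rat_mat D = rat_mat N2 * rat_mat M * rat_mat (?t N1)"
    unfolding DM using N1 N2 M by (simp add: rat_mat_mult_dim assoc_mult_mat_dim)
  have GD: "G = rat_mat N2 * rat_mat M * rat_mat (?t N1) + ?c C * R * ?c B"
    unfolding ratD[symmetric] H[symmetric] using G D by (intro eq_matI) auto
  obtain Ti where Ti: "Ti \<in> carrier_mat n n" "Ti * T = 1\<^sub>m n" using mat_inverse_exists[OF T] by blast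
  obtain Si where Si: "Si \<in> carrier_mat n n" "S * Si = 1\<^sub>m n" "Si * S = 1\<^sub>m n" using mat_inverse_exists[OF S] by blast
  have rat_prod: "rat_mat X * rat_mat Y = rat_mat (X * Y)" if "X \<in> carrier_mat a b" "Y \<in> carrier_mat b c"
    for X Y :: "'a poly mat" and a b c using rat_mat_mult[OF that] by simp
  have rat_sum: "rat_mat X + rat_mat Y = rat_mat (X + Y)" if "X \<in> carrier_mat a b" "Y \<in> carrier_mat a b"
    for X Y :: "'a poly mat" and a b using that by (intro eq_matI) auto
  have c_prod: "?c X * ?c Y = ?c (X * Y)" if "X \<in> carrier_mat n n" "Y \<in> carrier_mat n n"
    for X Y :: "'a mat" using rat_prod[of "const_mat X" n n "const_mat Y" n] const_mat_mult[OF that] that by simp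
  interpret sb: sbmb_blocks "rat_mat (char_pencil A)" R "?c T" "?c Ti" "?c S" "?c Si" "?c B" "?c C" "rat_mat M"
    "rat_mat K1" "rat_mat K1h" "rat_mat (?t N1)" "rat_mat (?t N1h)" "rat_mat (?t K2)" "rat_mat (?t K2h)"
    "rat_mat N2" "rat_mat N2h" G n p m ph mh
  proof unfold_locales
    show "?c Ti * ?c T = 1\<^sub>m n" using c_prod[OF Ti(1) T(1)] Ti by simp
    show "?c Si * ?c S = 1\<^sub>m n" using c_prod[OF Si(1) S(1)] Si by simp
    show "?c S * ?c Si = 1\<^sub>m n" using c_prod[OF S(1) Si(1)] Si by simp
    show "rat_mat K1 * rat_mat (?t N1) = 0\<^sub>m mh m"
      using rat_prod[of K1 mh "m + mh" "?t N1" m] K1 N1 u1 by simp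
    show "rat_mat K1h * rat_mat (?t N1) = 1\<^sub>m m"
      using rat_prod[of K1h m "m + mh" "?t N1" m] K1h N1 u1 by simp
    show "rat_mat N2 * rat_mat (?t K2) = 0\<^sub>m p ph"
      using rat_prod[of N2 p "p + ph" "?t K2" ph] N2 K2 u2t by simp
    show "rat_mat N2 * rat_mat (?t K2h) = 1\<^sub>m p"
      using rat_prod[of N2 p "p + ph" "?t K2h" p] N2 K2h u2t by simp
    show "rat_mat N2h * rat_mat (?t K2) = 1\<^sub>m ph"
      using rat_prod[of N2h ph "p + ph" "?t K2" ph] N2h K2 u2t by simp
    show "rat_mat N2h * rat_mat (?t K2h) = 0\<^sub>m ph p"
      using rat_prod[of N2h ph "p + ph" "?t K2h" p] N2h K2h u2t by simp
    have "rat_mat (?t N1h) * rat_mat K1 + rat_mat (?t N1) * rat_mat K1h = rat_mat (?t N1h * K1) + rat_mat (?t N1 * K1h)"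
      using rat_prod[of "?t N1h" "m + mh" mh K1 "m + mh"] rat_prod[of "?t N1" "m + mh" m K1h "m + mh"]
        N1h K1 N1 K1h by simp
    also have "\<dots> = rat_mat (?t N1h * K1 + ?t N1 * K1h)"
      by (rule rat_sum[of _ "m + mh" "m + mh"]) (use N1h K1 N1 K1h in auto)
    finally show "rat_mat (?t N1h) * rat_mat K1 + rat_mat (?t N1) * rat_mat K1h = 1\<^sub>m (m + mh)"
      unfolding u1(5) by simp
    have "rat_mat (?t K2) * rat_mat N2h + rat_mat (?t K2h) * rat_mat N2 = rat_mat (?t K2 * N2h) + rat_mat (?t K2h * N2)"
      using rat_prod[of "?t K2" "p + ph" ph N2h "p + ph"] rat_prod[of "?t K2h" "p + ph" p N2 "p + ph"]
        N2h K2 N2 K2h by simp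
    also have "\<dots> = rat_mat (?t K2 * N2h + ?t K2h * N2)"
      by (rule rat_sum[of _ "p + ph" "p + ph"]) (use N2h K2 N2 K2h in auto)
    finally show "rat_mat (?t K2) * rat_mat N2h + rat_mat (?t K2h) * rat_mat N2 = 1\<^sub>m (p + ph)"
      unfolding u2t(5) by simp
  qed (fact GD R | use A R T Ti S Si B C M K1 K1h N1 N1h K2 K2h N2 N2h in simp)+
  let ?L = "sbmb_lin T S A B C M K1 K2 K1h K2h"
  have L: "rat_mat ?L = sb.Lin"
  proof -
    have c1: "rat_mat (const_mat T * char_pencil A * const_mat S) = ?c T * rat_mat (char_pencil A) * ?c S"
      using A T S by (simp add: rat_mat_mult_dim assoc_mult_mat_dim)
    have c2: "rat_mat (const_mat T * const_mat B * K1h) = ?c T * ?c B * rat_mat K1h"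
      using T B K1h by (simp add: rat_mat_mult_dim assoc_mult_mat_dim)
    have c3: "rat_mat (- (?t K2h * const_mat C * const_mat S)) = - (rat_mat (?t K2h) * ?c C * ?c S)"
      using S C K2h by (simp add: rat_mat_uminus rat_mat_mult_dim assoc_mult_mat_dim)
    let ?A1 = "append_cols (append_cols (const_mat T * char_pencil A * const_mat S) (const_mat T * const_mat B * K1h)) (0\<^sub>m n ph)"
    let ?A2 = "append_cols (append_cols (- (?t K2h * const_mat C * const_mat S)) M) (?t K2)"
    let ?A3 = "append_cols (append_cols (0\<^sub>m mh n) K1) (0\<^sub>m mh ph)"
    have AA: "?A1 \<in> carrier_mat n (n + (m + mh) + ph)" "?A2 \<in> carrier_mat (p + ph) (n + (m + mh) + ph)"
      "?A3 \<in> carrier_mat mh (n + (m + mh) + ph)"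
      using T A S B K1h K2h C M K2 K1 by (intro append_cols_carrier; auto)+
    have app: "rat_mat (append_cols (append_cols X Y) Z) = append_cols (append_cols (rat_mat X) (rat_mat Y)) (rat_mat Z)"
      if "X \<in> carrier_mat a b" "Y \<in> carrier_mat a c" "Z \<in> carrier_mat a d" for X Y Z :: "'a poly mat" and a b c d
      using rat_mat_append_cols[OF append_cols_carrier[OF that(1,2)] that(3)] rat_mat_append_cols[OF that(1,2)] by simp
    have A1: "rat_mat ?A1 = append_cols (append_cols (?c T * rat_mat (char_pencil A) * ?c S) (?c T * ?c B * rat_mat K1h)) (0\<^sub>m n ph)"
      unfolding c1[symmetric] c2[symmetric] rat_mat_zero[symmetric]
      by (rule app[of _ n n _ "m + mh" _ ph]) (use T A S B K1h in auto)
    have A2: "rat_mat ?A2 = append_cols (append_cols (- (rat_mat (?t K2h) * ?c C * ?c S)) (rat_mat M)) (rat_mat (?t K2))"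
      unfolding c3[symmetric]
      by (rule app[of _ "p + ph" n _ "m + mh" _ ph]) (use K2h C S M K2 in auto)
    have A3: "rat_mat ?A3 = append_cols (append_cols (0\<^sub>m mh n) (rat_mat K1)) (0\<^sub>m mh ph)"
      unfolding rat_mat_zero[symmetric]
      by (rule app[of _ mh n _ "m + mh" _ ph]) (use K1 in auto)
    have "?L = ?A1 @\<^sub>r (?A2 @\<^sub>r ?A3)"
      unfolding sbmb_lin_def Let_def carrier_matD[OF A] carrier_matD[OF K1] carrier_matD[OF K2] ..
    thus ?thesis unfolding sb.Lin_def A1[symmetric] A2[symmetric] A3[symmetric]
      using rat_mat_append_rows[OF AA(1) carrier_append_rows[OF AA(2,3)]] rat_mat_append_rows[OF AA(2,3)] by simp
  qed
  \<comment> \<open>As \<open>m > 0\<close>, the matrix degree is attained by a row and is the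
    common row degree.\<close>
  have N1d: "row_degree N1 i = mat_degree N1" if "i < m" for i
    using mat_degree_eq_row_degree[OF N1 m, of "row_degree N1 i"] N1_deg that by metis
  have N1min': "minimal_basis_of (m + mh) (row_space (rat_mat N1)) N1"
    using N1_min N1 unfolding is_minimal_basis_def by simp
  have K2min': "minimal_basis_of (p + ph) (row_space (rat_mat K2)) K2"
    using K2_min K2 unfolding is_minimal_basis_def by simp
  have Linc: "dim_col sb.Lin = n + (m + mh) + ph" using carrier_matD[OF sb.Lin_carrier] by simp
  have Gc: "dim_col G = m" using G by simp
  show ?thesis
    unfolding L
  proof (rule right_minimal_indices_shift[OF _ _ sb.inverse_maps_Emb_Proj _ _ E]; (unfold Linc Gc)?)
    show "sb.Emb \<in> carrier_mat (n + (m + mh) + ph) m" by (rule sb.Emb_carrier)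
    show "sb.Proj \<in> carrier_mat m (n + (m + mh) + ph)" by (rule sb.Proj_carrier)
    fix w :: "'a poly vec" assume w: "w \<in> carrier_vec (n + (m + mh) + ph)"
    let ?Pr = "append_cols (append_cols (0\<^sub>m m n) K1h) (0\<^sub>m m ph)"
    have Pr: "?Pr \<in> carrier_mat m (n + (m + mh) + ph)" using K1h by (intro append_cols_carrier) auto
    have "rat_mat ?Pr = sb.Proj"
      unfolding sb.Proj_def rat_mat_zero[symmetric]
      using rat_mat_append_cols[OF append_cols_carrier[OF zero_carrier_mat[of m n] K1h] zero_carrier_mat[of m ph]]
        rat_mat_append_cols[OF zero_carrier_mat[of m n] K1h] by simp
    thus "\<exists>u\<in>carrier_vec m. rat_vec u = sb.Proj *\<^sub>v rat_vec w"
      using rat_mat_mult_vec[OF Pr w] mult_mat_vec_carrier[OF Pr w] by metis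
  next
    fix u :: "'a poly vec"
    assume u: "u \<in> carrier_vec m" "rat_vec u \<in> right_null_space G" "u \<noteq> 0\<^sub>v m"
    have ru: "rat_vec u \<in> carrier_vec m" using u by simp
    define f where "f = const_mat B *\<^sub>v u"
    have cB: "const_mat B \<in> carrier_mat n m" and cC: "const_mat C \<in> carrier_mat p n"
      and cSi: "const_mat Si \<in> carrier_mat n n" using B C Si by auto
    have tN1: "?t N1 \<in> carrier_mat (m + mh) m" and tK2: "?t K2 \<in> carrier_mat (p + ph) ph"
      and tK2h: "?t K2h \<in> carrier_mat (p + ph) p" using N1 K2 K2h by auto
    have f: "f \<in> carrier_vec n" unfolding f_def by (rule mult_mat_vec_carrier[OF cB u(1)])
    have rf: "rat_vec f = ?c B *\<^sub>v rat_vec u" unfolding f_def by (rule rat_mat_mult_vec[OF cB u(1)])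
    define y where "y = ?t N1 *\<^sub>v u"
    define My where "My = M *\<^sub>v y"
    define g where "g = N2 *\<^sub>v My"
    define z where "z = N2h *\<^sub>v My"
    have y: "y \<in> carrier_vec (m + mh)" unfolding y_def by (rule mult_mat_vec_carrier[OF tN1 u(1)])
    have My: "My \<in> carrier_vec (p + ph)" unfolding My_def by (rule mult_mat_vec_carrier[OF M y])
    have g: "g \<in> carrier_vec p" unfolding g_def by (rule mult_mat_vec_carrier[OF N2 My])
    have z: "z \<in> carrier_vec ph" unfolding z_def by (rule mult_mat_vec_carrier[OF N2h My])
    have ry: "rat_vec y = rat_mat (?t N1) *\<^sub>v rat_vec u" unfolding y_def by (rule rat_mat_mult_vec[OF tN1 u(1)])
    have rMy: "rat_vec My = rat_mat M *\<^sub>v rat_vec y" unfolding My_def by (rule rat_mat_mult_vec[OF M y])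
    have rg: "rat_vec g = rat_mat N2 *\<^sub>v rat_vec My" unfolding g_def by (rule rat_mat_mult_vec[OF N2 My])
    have rz: "rat_vec z = rat_mat N2h *\<^sub>v rat_vec My" unfolding z_def by (rule rat_mat_mult_vec[OF N2h My])
    let ?CRf = "?c C *\<^sub>v (R *\<^sub>v rat_vec f)"
    \<comment> \<open>The equation \<open>G u = 0\<close> says that the output of the rational state
      \<open>R f\<close> is the polynomial vector \<open>- g\<close>; observability then makes the
      state itself polynomial.\<close>
    have "rat_vec g + ?CRf = 0\<^sub>v p"
      using u(2) G unfolding right_null_space_def rg rMy ry rf by (simp add: sb.G_mult[OF ru])
    moreover have CRfc: "?CRf \<in> carrier_vec p" using C by (auto intro!: carrier_vecI)
    moreover have rgc: "rat_vec g \<in> carrier_vec p" using g by simp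
    ultimately have "?CRf + rat_vec g = 0\<^sub>v p" using comm_add_vec[OF CRfc rgc] by simp
    hence "?CRf = - rat_vec g" by (rule vec_add_zero_imp_uminus[OF CRfc rgc])
    hence CRf: "?CRf = rat_vec (- g)" by (simp add: rat_vec_uminus)
    obtain q where q: "q \<in> carrier_vec n" "rat_vec q = R *\<^sub>v rat_vec f"
      using observable_polynomial_state[OF obs A C R(1,2) f _ CRf] g by auto
    define x where "x = const_mat Si *\<^sub>v q"
    have x: "x \<in> carrier_vec n" unfolding x_def by (rule mult_mat_vec_carrier[OF cSi q(1)])
    have rx: "rat_vec x = ?c Si *\<^sub>v rat_vec q" unfolding x_def by (rule rat_mat_mult_vec[OF cSi q(1)])
    let ?w = "(- x @\<^sub>v y) @\<^sub>v - z"
    have w: "?w \<in> carrier_vec (n + (m + mh) + ph)" using x y z by auto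
    have rw: "rat_vec ?w = sb.Emb *\<^sub>v rat_vec u"
      unfolding sb.Emb_mult[OF ru] rat_vec_append rat_vec_uminus rx q(2) rf rz rMy ry ..
    have dy: "vec_degree y = vec_degree u + mat_degree N1"
      unfolding y_def by (rule minimal_basis_predictable_degree[OF N1min' N1 N1d u(1,3)])
    \<comment> \<open>Back over the polynomials, the state equation bounds the degree of
      \<open>q\<close> by that of \<open>f = B u\<close>, hence by that of \<open>u\<close>.\<close>
    have "rat_vec (char_pencil A *\<^sub>v q) = rat_mat (char_pencil A) *\<^sub>v (R *\<^sub>v rat_vec f)"
      unfolding q(2)[symmetric] by (rule rat_mat_mult_vec[OF char_pencil_carrier[OF A] q(1)])
    also have "\<dots> = rat_vec f" using sb.cancel(3)[of "rat_vec f"] f by simp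
    finally have Aq: "char_pencil A *\<^sub>v q = f" by (rule rat_vec_inj)
    have df: "vec_degree f \<le> vec_degree u" unfolding f_def by (rule vec_degree_const_mat_mult_le[OF B u(1)])
    hence dq: "vec_degree q \<le> vec_degree u" using vec_degree_state_le[OF A q(1) f Aq] by simp
    have dx: "vec_degree x \<le> vec_degree y"
      using vec_degree_const_mat_mult_le[OF Si(1) q(1)] dq dy unfolding x_def by linarith
    have "rat_vec (const_mat C *\<^sub>v q) = rat_vec (- g)"
      unfolding CRf[symmetric] q(2)[symmetric] by (rule rat_mat_mult_vec[OF cC q(1)])
    hence "const_mat C *\<^sub>v q = - g" by (rule rat_vec_inj)
    hence dg: "vec_degree g \<le> vec_degree q"
      using vec_degree_const_mat_mult_le[OF C q(1)] by simp
    \<comment> \<open>The definition of \<open>z\<close> through \<open>N2h\<close> yields no degree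
      bound. Instead \<open>K2^T z = M y - K2h^T g\<close>, where \<open>M y\<close> gains at most
      one degree over \<open>y\<close>, and \<open>g = - C q\<close> has degree at most that of
      \<open>u\<close> with \<open>K2h\<close> constant. Passing from \<open>z\<close> to
      \<open>K2^T z\<close> costs exactly one degree, which balances the one gained from
      \<open>M\<close>.\<close>
    have dz: "vec_degree z \<le> vec_degree y"
    proof (cases "z = 0\<^sub>v ph")
      case False
      have "My = (?t K2 * N2h + ?t K2h * N2) *\<^sub>v My" unfolding u2t(5) using My by simp
      also have "\<dots> = (?t K2 * N2h) *\<^sub>v My + (?t K2h * N2) *\<^sub>v My"
        by (rule add_mult_distrib_mat_vec) (use tK2 N2h tK2h N2 My in auto)
      also have "\<dots> = ?t K2 *\<^sub>v z + ?t K2h *\<^sub>v g"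
        unfolding z_def g_def using assoc_mult_mat_vec[OF tK2 N2h My] assoc_mult_mat_vec[OF tK2h N2 My] by simp
      finally have "?t K2 *\<^sub>v z = My - ?t K2h *\<^sub>v g"
        using K2 K2h My by (intro eq_vecI) auto
      moreover have "vec_degree My \<le> 1 + vec_degree y"
        unfolding My_def
      proof (rule vec_degree_mult_le)
        show "degree (M $$ (i, j)) \<le> 1" if "i < dim_row M" "j < dim_col M" for i j
          using degree_le_mat_degree[OF that] M_pencil by simp
      qed (use M y in auto)
      moreover have "vec_degree (?t K2h *\<^sub>v g) \<le> 0 + vec_degree g"
        by (rule vec_degree_mult_le) (use K2h g K2h_const in \<open>auto simp: is_constant_mat_def\<close>)
      ultimately have "vec_degree (?t K2 *\<^sub>v z) \<le> 1 + vec_degree y"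
        using dg dq dy My K2h by (auto intro!: vec_degree_diff_le)
      moreover have "vec_degree (?t K2 *\<^sub>v z) = vec_degree z + 1"
        by (rule minimal_basis_predictable_degree[OF K2min' K2 _ z False]) (use K2_deg in simp)
      ultimately show ?thesis by simp
    qed simp
    have "vec_degree ?w = vec_degree u + mat_degree N1"
      unfolding vec_degree_append using dx dz dy by simp
    with w rw show "\<exists>w\<in>carrier_vec (n + (m + mh) + ph). rat_vec w = sb.Emb *\<^sub>v rat_vec u \<and>
        vec_degree w = vec_degree u + mat_degree N1" by blast
  qed
qed

section \<open>Transposition of the block pencil\<close>

text \<open>The nesting copies that of \<open>sbmb_lin\<close>, so both linearizations unfold to
  this form by reflexivity and transposition reduces to an index computation.\<close>

definition block_mat3 where
  "block_mat3 X11 X12 X13 X21 X22 X23 X31 X32 X33 =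
     append_cols (append_cols X11 X12) X13 @\<^sub>r append_cols (append_cols X21 X22) X23
     @\<^sub>r append_cols (append_cols X31 X32) X33"

lemma block_mat3_carrier:
  assumes "X11 \<in> carrier_mat a1 b1" "X12 \<in> carrier_mat a1 b2" "X13 \<in> carrier_mat a1 b3"
    "X21 \<in> carrier_mat a2 b1" "X22 \<in> carrier_mat a2 b2" "X23 \<in> carrier_mat a2 b3"
    "X31 \<in> carrier_mat a3 b1" "X32 \<in> carrier_mat a3 b2" "X33 \<in> carrier_mat a3 b3"
  shows "block_mat3 X11 X12 X13 X21 X22 X23 X31 X32 X33 \<in> carrier_mat (a1 + (a2 + a3)) (b1 + b2 + b3)"
  unfolding block_mat3_def using assms by (intro carrier_append_rows append_cols_carrier)

lemma block_mat3_index: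
  assumes X: "X11 \<in> carrier_mat a1 b1" "X12 \<in> carrier_mat a1 b2" "X13 \<in> carrier_mat a1 b3"
    "X21 \<in> carrier_mat a2 b1" "X22 \<in> carrier_mat a2 b2" "X23 \<in> carrier_mat a2 b3"
    "X31 \<in> carrier_mat a3 b1" "X32 \<in> carrier_mat a3 b2" "X33 \<in> carrier_mat a3 b3"
    and ij: "i < a1 + (a2 + a3)" "j < b1 + b2 + b3"
  shows "block_mat3 X11 X12 X13 X21 X22 X23 X31 X32 X33 $$ (i, j) =
    (if i < a1 then
       if j < b1 then X11 $$ (i, j) else if j < b1 + b2 then X12 $$ (i, j - b1) else X13 $$ (i, j - b1 - b2)
     else if i < a1 + a2 then
       if j < b1 then X21 $$ (i - a1, j) else if j < b1 + b2 then X22 $$ (i - a1, j - b1) else X23 $$ (i - a1, j - b1 - b2)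
     else
       if j < b1 then X31 $$ (i - a1 - a2, j) else if j < b1 + b2 then X32 $$ (i - a1 - a2, j - b1)
       else X33 $$ (i - a1 - a2, j - b1 - b2))"
proof -
  note c1 = append_cols_carrier[OF append_cols_carrier[OF X(1,2)] X(3)]
  note c2 = append_cols_carrier[OF append_cols_carrier[OF X(4,5)] X(6)]
  note c3 = append_cols_carrier[OF append_cols_carrier[OF X(7,8)] X(9)]
  have row: "append_cols (append_cols Y1 Y2) Y3 $$ (k, j) =
      (if j < b1 then Y1 $$ (k, j) else if j < b1 + b2 then Y2 $$ (k, j - b1) else Y3 $$ (k, j - b1 - b2))"
    if "Y1 \<in> carrier_mat a b1" "Y2 \<in> carrier_mat a b2" "Y3 \<in> carrier_mat a b3" "k < a" for Y1 Y2 Y3 :: "'a mat" and a k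
    using append_cols_index[OF append_cols_carrier[OF that(1,2)] that(3,4) ij(2)]
      append_cols_index[OF that(1,2,4), of j] by auto
  show ?thesis
    unfolding block_mat3_def append_rows_index[OF c1 carrier_append_rows[OF c2 c3] ij]
    using append_rows_index[OF c2 c3, of "i - a1" j] ij
      row[OF X(1-3), of i] row[OF X(4-6), of "i - a1"] row[OF X(7-9), of "i - a1 - a2"]
    by (auto simp: less_diff_conv2)
qed

lemma block_mat3_transpose:
  assumes X: "X11 \<in> carrier_mat a1 b1" "X12 \<in> carrier_mat a1 b2" "X13 \<in> carrier_mat a1 b3"
    "X21 \<in> carrier_mat a2 b1" "X22 \<in> carrier_mat a2 b2" "X23 \<in> carrier_mat a2 b3"
    "X31 \<in> carrier_mat a3 b1" "X32 \<in> carrier_mat a3 b2" "X33 \<in> carrier_mat a3 b3"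
  shows "transpose_mat (block_mat3 X11 X12 X13 X21 X22 X23 X31 X32 X33) =
    block_mat3 (transpose_mat X11) (transpose_mat X21) (transpose_mat X31)
      (transpose_mat X12) (transpose_mat X22) (transpose_mat X32)
      (transpose_mat X13) (transpose_mat X23) (transpose_mat X33)" (is "transpose_mat ?L = ?R")
proof -
  have t: "transpose_mat X11 \<in> carrier_mat b1 a1" "transpose_mat X21 \<in> carrier_mat b1 a2" "transpose_mat X31 \<in> carrier_mat b1 a3"
    "transpose_mat X12 \<in> carrier_mat b2 a1" "transpose_mat X22 \<in> carrier_mat b2 a2" "transpose_mat X32 \<in> carrier_mat b2 a3"
    "transpose_mat X13 \<in> carrier_mat b3 a1" "transpose_mat X23 \<in> carrier_mat b3 a2" "transpose_mat X33 \<in> carrier_mat b3 a3"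
    using X by auto
  note L = block_mat3_carrier[OF X] and R = block_mat3_carrier[OF t]
  show ?thesis
  proof (rule eq_matI)
    fix i j assume "i < dim_row ?R" "j < dim_col ?R"
    hence ij: "i < b1 + (b2 + b3)" "j < a1 + a2 + a3" using carrier_matD[OF R] by auto
    hence ji: "j < a1 + (a2 + a3)" "i < b1 + b2 + b3" by auto
    have "transpose_mat ?L $$ (i, j) = ?L $$ (j, i)" using ji carrier_matD[OF L] by simp
    thus "transpose_mat ?L $$ (i, j) = ?R $$ (i, j)"
      unfolding block_mat3_index[OF X ji] block_mat3_index[OF t ij] using X ij
      by (auto simp: not_less less_diff_conv2)
  qed (use carrier_matD[OF L] carrier_matD[OF R] in auto)
qed

text \<open>The off-diagonal state blocks trade places. Replacing \<open>B\<close> by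
  \<open>- C^T\<close> and \<open>C\<close> by \<open>- B^T\<close> restores the sign pattern, and
  \<open>S\<close> and \<open>T\<close> exchange roles because they multiply the pencil from
  opposite sides.\<close>

lemma sbmb_lin_transpose:
  fixes A :: "'a::field mat"
  assumes A: "A \<in> carrier_mat n n" and B: "B \<in> carrier_mat n m" and C: "C \<in> carrier_mat p n"
    and M: "M \<in> carrier_mat c2 c1"
    and K1: "K1 \<in> carrier_mat mh c1" and K2: "K2 \<in> carrier_mat ph c2"
    and K1h: "K1h \<in> carrier_mat m c1" and K2h: "K2h \<in> carrier_mat p c2"
    and T: "T \<in> carrier_mat n n" and S: "S \<in> carrier_mat n n"
  shows "transpose_mat (sbmb_lin T S A B C M K1 K2 K1h K2h) =
    sbmb_lin (transpose_mat S) (transpose_mat T) (transpose_mat A) (- transpose_mat C) (- transpose_mat B)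
      (transpose_mat M) K2 K1 K2h K1h"
proof -
  let ?t = transpose_mat
  have L: "sbmb_lin T S A B C M K1 K2 K1h K2h = block_mat3
      (const_mat T * char_pencil A * const_mat S) (const_mat T * const_mat B * K1h) (0\<^sub>m n ph)
      (- (?t K2h * const_mat C * const_mat S)) M (?t K2) (0\<^sub>m mh n) K1 (0\<^sub>m mh ph)"
    unfolding sbmb_lin_def block_mat3_def Let_def carrier_matD[OF A] carrier_matD[OF K1] carrier_matD[OF K2] ..
  have At: "?t A \<in> carrier_mat n n" using A by simp
  have L': "sbmb_lin (?t S) (?t T) (?t A) (- ?t C) (- ?t B) (?t M) K2 K1 K2h K1h = block_mat3
      (const_mat (?t S) * char_pencil (?t A) * const_mat (?t T)) (const_mat (?t S) * const_mat (- ?t C) * K2h) (0\<^sub>m n mh)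
      (- (?t K1h * const_mat (- ?t B) * const_mat (?t T))) (?t M) (?t K1) (0\<^sub>m ph n) K2 (0\<^sub>m ph mh)"
    unfolding sbmb_lin_def block_mat3_def Let_def carrier_matD[OF At] carrier_matD[OF K1] carrier_matD[OF K2] ..
  have "?t (const_mat T * char_pencil A * const_mat S) = const_mat (?t S) * char_pencil (?t A) * const_mat (?t T)"
    using T A S by (simp add: transpose_mult_dim assoc_mult_mat_dim char_pencil_transpose[OF A] const_mat_transpose)
  moreover have "?t (const_mat T * const_mat B * K1h) = - (?t K1h * const_mat (- ?t B) * const_mat (?t T))"
    using T B K1h by (simp add: transpose_mult_dim assoc_mult_mat_dim const_mat_transpose const_mat_uminus)
  moreover have "?t (- (?t K2h * const_mat C * const_mat S)) = const_mat (?t S) * const_mat (- ?t C) * K2h"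
    using C S K2h by (simp add: transpose_mult_dim transpose_uminus assoc_mult_mat_dim const_mat_transpose const_mat_uminus)
  moreover have "?t (block_mat3
      (const_mat T * char_pencil A * const_mat S) (const_mat T * const_mat B * K1h) (0\<^sub>m n ph)
      (- (?t K2h * const_mat C * const_mat S)) M (?t K2) (0\<^sub>m mh n) K1 (0\<^sub>m mh ph)) = block_mat3
      (?t (const_mat T * char_pencil A * const_mat S)) (?t (- (?t K2h * const_mat C * const_mat S))) (?t (0\<^sub>m mh n))
      (?t (const_mat T * const_mat B * K1h)) (?t M) (?t K1) (?t (0\<^sub>m n ph)) (?t (?t K2)) (?t (0\<^sub>m mh ph))"
    by (rule block_mat3_transpose[of _ n n _ c1 _ ph _ c2 _ _ _ mh]) (use A B C M K1 K2 K1h K2h T S in auto)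
  ultimately show ?thesis unfolding L L' by simp
qed

lemma left_minimal_indices_transpose: "left_minimal_indices G E \<longleftrightarrow> right_minimal_indices (transpose_mat G) E"
  unfolding left_minimal_indices_def right_minimal_indices_def left_null_space_def right_null_space_def by simp

theorem theorem6p7:
  fixes G :: "'a::field poly fract mat"
    and D M K1 K2 N1 N2 K1h K2h N1h N2h :: "'a poly mat"
    and A B C T S :: "'a mat"
    and n m p mh ph :: nat
  assumes G: "G \<in> carrier_mat p m"
    and D: "D \<in> carrier_mat p m"
    and A: "A \<in> carrier_mat n n" and B: "B \<in> carrier_mat n m" and C: "C \<in> carrier_mat p n"
    and realization: "minimal_realization A B C (G - rat_mat D)"
    and degD: "mat_degree D > 1"
    and K1: "K1 \<in> carrier_mat mh (m + mh)" and K2: "K2 \<in> carrier_mat ph (p + ph)"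
    and N1: "N1 \<in> carrier_mat m (m + mh)" and N2: "N2 \<in> carrier_mat p (p + ph)"
    and K1_min: "is_minimal_basis K1" and K2_min: "is_minimal_basis K2"
    and K1_deg: "\<forall>i<mh. row_degree K1 i = 1" and K2_deg: "\<forall>i<ph. row_degree K2 i = 1"
    and dual1: "dual_minimal_bases K1 N1" and dual2: "dual_minimal_bases K2 N2"
    and N1_deg: "\<forall>i<m. \<forall>j<m. row_degree N1 i = row_degree N1 j"
    and N2_deg: "\<forall>i<p. \<forall>j<p. row_degree N2 i = row_degree N2 j"
    and M: "M \<in> carrier_mat (p + ph) (m + mh)" and M_pencil: "mat_degree M \<le> 1"
    and DM: "D = N2 * M * transpose_mat N1"
    and degDN: "mat_degree D = mat_degree N1 + mat_degree N2 + 1"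
    and K1h: "K1h \<in> carrier_mat m (m + mh)" and K1h_const: "is_constant_mat K1h"
    and K2h: "K2h \<in> carrier_mat p (p + ph)" and K2h_const: "is_constant_mat K2h"
    and N1h: "N1h \<in> carrier_mat mh (m + mh)" and N2h: "N2h \<in> carrier_mat ph (p + ph)"
    and unimod1: "(K1 @\<^sub>r K1h) * append_cols (transpose_mat N1h) (transpose_mat N1) = 1\<^sub>m (m + mh)"
      "append_cols (transpose_mat N1h) (transpose_mat N1) * (K1 @\<^sub>r K1h) = 1\<^sub>m (m + mh)"
    and unimod2: "(K2 @\<^sub>r K2h) * append_cols (transpose_mat N2h) (transpose_mat N2) = 1\<^sub>m (p + ph)"
      "append_cols (transpose_mat N2h) (transpose_mat N2) * (K2 @\<^sub>r K2h) = 1\<^sub>m (p + ph)"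
    and T: "T \<in> carrier_mat n n" "det T \<noteq> 0"
    and S: "S \<in> carrier_mat n n" "det S \<noteq> 0"
  defines "L \<equiv> sbmb_lin T S A B C M K1 K2 K1h K2h"
  shows "(\<forall>E. right_minimal_indices G E \<longrightarrow>
            right_minimal_indices (rat_mat L) (image_mset (\<lambda>e. e + mat_degree N1) E))
       \<and> (\<forall>E. left_minimal_indices G E \<longrightarrow>
            left_minimal_indices (rat_mat L) (image_mset (\<lambda>e. e + mat_degree N2) E))"
proof (intro conjI allI impI)
  \<comment> \<open>A minimal basis has strictly fewer rows than columns, which excludes the
    degenerate sizes.\<close>
  have m: "m > 0" and p: "p > 0" using K1_min K1 K2_min K2 unfolding is_minimal_basis_def by auto
  have min: "is_minimal_basis K1" "is_minimal_basis K2" "is_minimal_basis N1" "is_minimal_basis N2"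
    using dual1 dual2 unfolding dual_minimal_bases_def by auto
  {
    fix E assume E: "right_minimal_indices G E"
    show "right_minimal_indices (rat_mat L) (image_mset (\<lambda>e. e + mat_degree N1) E)"
      unfolding L_def
      by (rule sbmb_lin_right_minimal_indices[OF G A B C realization K1 K2 N1 N2 min(3,2) m K2_deg N1_deg
            M M_pencil DM K1h K2h K2h_const N1h N2h unimod1 unimod2 T S E])
  }
  fix E assume E: "left_minimal_indices G E"
  let ?t = transpose_mat
  have G': "?t G \<in> carrier_mat m p" and A': "?t A \<in> carrier_mat n n" and B': "- ?t C \<in> carrier_mat n p"
    and C': "- ?t B \<in> carrier_mat m n" and M': "?t M \<in> carrier_mat (m + mh) (p + ph)"
    and S': "?t S \<in> carrier_mat n n" and T': "?t T \<in> carrier_mat n n"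
    using G A B C M S T by auto
  have S'': "det (?t S) \<noteq> 0" and T'': "det (?t T) \<noteq> 0"
    using det_transpose[OF S(1)] det_transpose[OF T(1)] S T by auto
  \<comment> \<open>The strictly proper part of the transposed matrix is the transpose of the
    original one, so its minimal realization is inherited.\<close>
  have real': "minimal_realization (?t A) (- ?t C) (- ?t B) (?t G - rat_mat (?t D))"
    using minimal_realization_transpose[OF realization] transpose_minus[OF G, of "rat_mat D"] D
    by (simp add: rat_mat_transpose)
  have DM': "?t D = N1 * ?t M * ?t N2"
    unfolding DM using N1 N2 M by (simp add: transpose_mult_dim assoc_mult_mat_dim)
  have M_pencil': "mat_degree (?t M) \<le> 1" using M_pencil by (simp add: mat_degree_transpose)
  have E': "right_minimal_indices (?t G) E" using E by (simp add: left_minimal_indices_transpose)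
  have "right_minimal_indices (rat_mat (sbmb_lin (?t S) (?t T) (?t A) (- ?t C) (- ?t B) (?t M) K2 K1 K2h K1h))
      (image_mset (\<lambda>e. e + mat_degree N2) E)"
    \<comment> \<open>All data of sides 1 and 2 are interchanged: now \<open>N2\<close> supplies the
      shift, and \<open>K1\<close> with row degrees 1 bounds the third block.\<close>
    by (rule sbmb_lin_right_minimal_indices[OF G' A' B' C' real' K2 K1 N2 N1 min(4,1) p K1_deg N2_deg
          M' M_pencil' DM' K2h K1h K1h_const N2h N1h unimod2 unimod1 S' S'' T' T'' E'])
  thus "left_minimal_indices (rat_mat L) (image_mset (\<lambda>e. e + mat_degree N2) E)"
    unfolding L_def left_minimal_indices_transpose rat_mat_transpose[symmetric]
      sbmb_lin_transpose[OF A B C M K1 K2 K1h K2h T(1) S(1)] .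
qed

end
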